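(* Suppose that the network is strongly connected and that, for every input set $S$, $\mathrm{rank}(A|T_B(S))=n$ implies $\mathrm{rank}((zF-A)|T_B(S))=n$ for all $z\in\mathbb{C}$, so that the minimum-size input selection problem for controllability is $$\text{maximize}\ |R|\quad\text{s.t.}\quad R\in\mathcal{M}_1^{\ast},\qquad S=V\setminus R.$$ Then the greedy algorithm which starts with $R=\emptyset$, runs over $i=1,2,\dots,n$ and, for each $i$, replaces $R$ by $R\cup\{i\}$ whenever $(R\cup\{i\})\in\mathcal{M}_1^{\ast}$, returns the minimum-size input set $S=V\setminus R$ to guarantee controllability within $O(n)$ computations of the matroid independence condition $R\in\mathcal{M}_1^{\ast}$.
   Context: $V=\{1,\dots,n\}$ indexes the states of $F\dot{\mathbf{x}}(t)=A\mathbf{x}(t)$, where $F=Q_F+T_F$, $A=Q_A+T_A$ are $n\times n$; $Q_F,Q_A$ are known fixed real matrices and $T_F,T_A$ are structure matrices whose nonzero entries are independent free real parameters. The system is assumed solvable: for every initial state there is a unique trajectory. For input set $S\subseteq V$ the controlled system is represented by $F\dot{\mathbf{x}}=A\mathbf{x}+T_B(S)\mathbf{u}$, where $T_B(S)$ is the $n\times n$ diagonal matrix with a free parameter in the $i$-th diagonal entry for $i\in S$ and zeros elsewhere. Rank conditions are for almost all values of the free parameters. Under solvability, structural controllability is equivalent to $\mathrm{rank}(A|B)=n$ together with $\mathrm{rank}((A-zF)|B)=n$ for all $z\in\mathbb{C}$, with $B=T_B(S)$, and $\mathrm{rank}(A|T_B(S))=n$ is equivalent to $V\setminus S\in\mathcal{M}_1^{\ast}$.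 The network is strongly connected if, in the directed graph on $V$ with an edge $(i,j)$ whenever $F_{ji}\ne0$ or $A_{ji}\neq0$, there is a directed path from any node to any other node. $\mathcal{M}([I|Q_A|0])$ and $\mathcal{M}([I|T_A|T_B(S)])$ denote the linear matroids on the common set of $3n$ column indices (free parameters algebraically independent); $\vee$ is matroid union. $\rho_1(S)=\mathrm{rank}(\mathcal{M}([I|Q_A|0])\vee\mathcal{M}([I|T_A|T_B(S)]))-\mathrm{rank}(\mathcal{M}([I|Q_A])\vee\mathcal{M}([I|T_A]))$ is the rank function of a matroid $\mathcal{M}_1$ on $V$; $\mathcal{M}_1^{\ast}$ is its dual; $R\in\mathcal{M}_1^{\ast}$ means $R$ is independent in $\mathcal{M}_1^{\ast}$. *)

theory Defs
  imports
    "HOL-Analysis.Analysis"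
    "HOL-Library.Poly_Mapping"
    "HOL-Library.Countable"
    "HOL-Computational_Algebra.Fraction_Field"
begin

section \<open>Structured matrices\<close>

text \<open>
  The states \<open>1, \<dots>, n\<close> are the elements of a type \<open>'n\<close> of class \<open>{finite, linorder}\<close>, so that
  \<open>n\<close> is \<open>CARD('n)\<close> and the order of the states is the order of the type.
  A structure matrix is given by the set \<open>P\<close> of positions of its nonzero entries; the entries
  of \<open>t\<close> at these positions are its free parameters. The entries may be real parameter
  values or indeterminates, see below.
\<close>

definition struct_mat :: "('n \<times> 'n) set \<Rightarrow> 'a::zero^'n^'n \<Rightarrow> 'a^'n^'n" where
  "struct_mat P t = (\<chi> i j. if (i, j) \<in> P then t $ i $ j else 0)"

definition input_mat :: "'n set \<Rightarrow> 'a::zero^'n \<Rightarrow> 'a^'n^'n" where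
  "input_mat S b = (\<chi> i j. if i = j \<and> i \<in> S then b $ i else 0)"

definition hcat :: "'a^'m^'r \<Rightarrow> 'a^'k^'r \<Rightarrow> 'a^('m + 'k)^'r" where
  "hcat M N = (\<chi> i c. case c of Inl j \<Rightarrow> M $ i $ j | Inr j \<Rightarrow> N $ i $ j)"

definition cmat :: "real^'m^'r \<Rightarrow> complex^'m^'r" where
  "cmat M = (\<chi> i j. complex_of_real (M $ i $ j))"

definition pencil :: "complex \<Rightarrow> real^'n^'n \<Rightarrow> real^'n^'n \<Rightarrow> complex^'n^'n" where
  "pencil z F A = (\<chi> i j. z * complex_of_real (F $ i $ j) - complex_of_real (A $ i $ j))"

text \<open>
  Values of the free parameters of \<open>T\<^sub>F\<close>, \<open>T\<^sub>A\<close> and \<open>T\<^sub>B\<close>. Coordinates outside the prescribed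
  positions are not used by the matrices, hence "for almost all values of the free parameters" can be
  expressed by Lebesgue measure on the whole space.
\<close>

type_synonym 'n params = "(real^'n^'n) \<times> (real^'n^'n) \<times> (real^'n)"

definition F_at :: "real^'n^'n \<Rightarrow> ('n \<times> 'n) set \<Rightarrow> 'n params \<Rightarrow> real^'n^'n" where
  "F_at QF PF \<theta> = QF + struct_mat PF (fst \<theta>)"

definition A_at :: "real^'n^'n \<Rightarrow> ('n \<times> 'n) set \<Rightarrow> 'n params \<Rightarrow> real^'n^'n" where
  "A_at QA PA \<theta> = QA + struct_mat PA (fst (snd \<theta>))"

definition B_at :: "'n set \<Rightarrow> 'n params \<Rightarrow> real^'n^'n" where
  "B_at S \<theta> = input_mat S (snd (snd \<theta>))"

definition strongly_connected :: "real^'n^'n \<Rightarrow> real^'n^'n \<Rightarrow> bool" where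
  "strongly_connected F A \<longleftrightarrow>
     (\<forall>i j. i \<noteq> j \<longrightarrow> (i, j) \<in> {(i, j). F $ j $ i \<noteq> 0 \<or> A $ j $ i \<noteq> 0}\<^sup>+)"


section \<open>Solvability and controllability of descriptor systems\<close>

text \<open>\<open>x\<close> solves \<open>F x' = A x + f\<close> on \<open>[0, \<infinity>)\<close>.\<close>

definition is_trajectory ::
    "real^'n^'n \<Rightarrow> real^'n^'n \<Rightarrow> (real \<Rightarrow> real^'n) \<Rightarrow> (real \<Rightarrow> real^'n) \<Rightarrow> bool" where
  "is_trajectory F A f x \<longleftrightarrow>
     (\<forall>t\<ge>0. \<exists>v. (x has_vector_derivative v) (at t within {0..}) \<and> F *v v = A *v x t + f t)"

definition is_controlled_trajectory ::
    "real^'n^'n \<Rightarrow> real^'n^'n \<Rightarrow> real^'m^'n \<Rightarrow> (real \<Rightarrow> real^'m) \<Rightarrow> (real \<Rightarrow> real^'n) \<Rightarrow> bool" where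
  "is_controlled_trajectory F A B u x \<longleftrightarrow>
     continuous_on {0..} u \<and> is_trajectory F A (\<lambda>t. B *v u t) x"

text \<open>
  If \<open>F\<close> is singular, then \<open>F x' = A x + B u\<close> contains algebraic equations, and only the
  states compatible with them can occur as initial states. If \<open>F\<close> is invertible, every
  state is an initial state.
\<close>

definition autonomous_initial_states :: "real^'n^'n \<Rightarrow> real^'n^'n \<Rightarrow> (real^'n) set" where
  "autonomous_initial_states F A = {x 0 | x. is_trajectory F A (\<lambda>t. 0) x}"

definition controlled_initial_states ::
    "real^'n^'n \<Rightarrow> real^'n^'n \<Rightarrow> real^'m^'n \<Rightarrow> (real^'n) set" where
  "controlled_initial_states F A B = {x 0 | x. \<exists>u. is_controlled_trajectory F A B u x}"

definition solvable :: "real^'n^'n \<Rightarrow> real^'n^'n \<Rightarrow> bool" where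
  "solvable F A \<longleftrightarrow>
     (\<forall>x0 \<in> autonomous_initial_states F A.
        \<exists>x. x 0 = x0 \<and> is_trajectory F A (\<lambda>t. 0) x \<and>
            (\<forall>y. y 0 = x0 \<and> is_trajectory F A (\<lambda>t. 0) y \<longrightarrow> (\<forall>t\<ge>0. y t = x t)))"

definition controllable :: "real^'n^'n \<Rightarrow> real^'n^'n \<Rightarrow> real^'m^'n \<Rightarrow> bool" where
  "controllable F A B \<longleftrightarrow>
     (\<forall>x0 \<in> controlled_initial_states F A B. \<forall>x1 \<in> controlled_initial_states F A B.
        \<exists>T>0. \<exists>u x. is_controlled_trajectory F A B u x \<and> x 0 = x0 \<and> x T = x1)"

definition structurally_controllable ::
    "real^'n^'n \<Rightarrow> ('n \<times> 'n) set \<Rightarrow> real^'n^'n \<Rightarrow> ('n \<times> 'n) set \<Rightarrow> 'n::finite set \<Rightarrow> bool" where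
  "structurally_controllable QF PF QA PA S \<longleftrightarrow>
     (AE \<theta> in lborel. controllable (F_at QF PF \<theta>) (A_at QA PA \<theta>) (B_at S \<theta>))"


section \<open>Matroids\<close>

text \<open>Matroids are represented by their families of independent sets.\<close>

definition linear_matroid :: "'a::field^'c^'r \<Rightarrow> 'c set set" where
  "linear_matroid M =
     {J. inj_on (\<lambda>j. column j M) J \<and> vec.independent ((\<lambda>j. column j M) ` J)}"

definition matroid_union :: "'c set set \<Rightarrow> 'c set set \<Rightarrow> 'c set set" where
  "matroid_union M N = {I \<union> J | I J. I \<in> M \<and> J \<in> N}"

definition matroid_rank :: "'c::finite set set \<Rightarrow> nat" where
  "matroid_rank M = Max (card ` M)"

definition matroid_basis :: "'c set set \<Rightarrow> 'c set \<Rightarrow> bool" where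
  "matroid_basis M B \<longleftrightarrow> B \<in> M \<and> (\<forall>I \<in> M. B \<subseteq> I \<longrightarrow> I = B)"

definition dual_matroid :: "'c set set \<Rightarrow> 'c set set" where
  "dual_matroid M = {R. \<exists>B. matroid_basis M B \<and> R \<inter> B = {}}"

text \<open>
  Algebraically independent parameters: the field of rational functions over the reals in
  indeterminates numbered by natural numbers. The entry \<open>(i, j)\<close> of \<open>T\<^sub>A\<close> and the
  \<open>i\<close>-th diagonal entry of \<open>T\<^sub>B\<close> are the indeterminates with the codes of
  \<open>Inl (i, j)\<close> and \<open>Inr i\<close>.
\<close>

type_synonym ratfun = "((nat \<Rightarrow>\<^sub>0 nat) \<Rightarrow>\<^sub>0 real) fract"

definition indet :: "'v::countable \<Rightarrow> ratfun" where
  "indet v = Fract (Poly_Mapping.single (Poly_Mapping.single (to_nat v) 1) 1) 1"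

definition generic_TA :: "('n::finite \<times> 'n) set \<Rightarrow> ratfun^'n^'n" where
  "generic_TA PA = struct_mat PA (\<chi> i j. indet (Inl (i, j) :: ('n \<times> 'n) + 'n))"

definition generic_TB :: "'n::finite set \<Rightarrow> ratfun^'n^'n" where
  "generic_TB S = input_mat S (\<chi> i. indet (Inr i :: ('n \<times> 'n) + 'n))"

text \<open>
  The subtraction does not truncate: the second union is the restriction of the first one to
  the first \<open>2 n\<close> columns.
\<close>

definition rho1 :: "real^'n^'n \<Rightarrow> ('n \<times> 'n) set \<Rightarrow> 'n::finite set \<Rightarrow> nat" where
  "rho1 QA PA S =
     matroid_rank (matroid_union
       (linear_matroid (hcat (mat 1 :: real^'n^'n) (hcat QA (0 :: real^'n^'n))))
       (linear_matroid (hcat (mat 1 :: ratfun^'n^'n) (hcat (generic_TA PA) (generic_TB S)))))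
     - matroid_rank (matroid_union
       (linear_matroid (hcat (mat 1 :: real^'n^'n) QA))
       (linear_matroid (hcat (mat 1 :: ratfun^'n^'n) (generic_TA PA))))"

definition matroid_M1 :: "real^'n^'n \<Rightarrow> ('n \<times> 'n) set \<Rightarrow> 'n::finite set set" where
  "matroid_M1 QA PA = {X. rho1 QA PA X = card X}"


section \<open>Algorithms with an independence oracle\<close>

text \<open>
  A program has access to the matroid only through the answers to its queries, so that
  \<open>num_queries\<close> counts all computations of the independence condition.
\<close>

datatype ('q, 'a) query_prog = Return 'a | Query 'q "bool \<Rightarrow> ('q, 'a) query_prog"

primrec run_prog :: "('q \<Rightarrow> bool) \<Rightarrow> ('q, 'a) query_prog \<Rightarrow> 'a" where
  "run_prog orc (Return a) = a"
| "run_prog orc (Query q k) = run_prog orc (k (orc q))"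

primrec num_queries :: "('q \<Rightarrow> bool) \<Rightarrow> ('q, 'a) query_prog \<Rightarrow> nat" where
  "num_queries orc (Return a) = 0"
| "num_queries orc (Query q k) = Suc (num_queries orc (k (orc q)))"

primrec greedy_loop :: "'v list \<Rightarrow> 'v set \<Rightarrow> ('v set, 'v set) query_prog" where
  "greedy_loop [] R = Return R"
| "greedy_loop (i # vs) R =
     Query (insert i R) (\<lambda>b. greedy_loop vs (if b then insert i R else R))"

definition greedy :: "('n::{finite, linorder} set, 'n set) query_prog" where
  "greedy = greedy_loop (sorted_list_of_set UNIV) {}"

end

theory Submission
  imports Defs "HOL-Computational_Algebra.Fundamental_Theorem_Algebra"
begin

text \<open>
  Let \<open>r S\<close> be the largest rank that \<open>[A | T\<^sub>B(S)]\<close> attains. The proof rests on two equivalences: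
  structural controllability with input set \<open>S\<close> means \<open>r S = n\<close>, and \<open>r S = n\<close> means
  that the complement of \<open>S\<close> is independent in the dual of \<open>M\<^sub>1\<close>. Correctness of the greedy
  algorithm is then a fact about vectors: completing the columns of \<open>A\<close> to a
  spanning set by unit vectors, all completions that are minimal under inclusion have the same size.

  \<^emph>\<open>Rank and matroids.\<close> For a real matrix \<open>Q\<close> and a pattern \<open>P\<close> of free parameters, the rank of
  \<open>M([I | Q]) \<or> M([I | T])\<close> is \<open>n\<close> plus the maximal rank of \<open>Q + T\<close>. Both inequalities
  stack the columns of the two matrices to vectors in a space of dimension \<open>2 n\<close> and rest on one exchange
  principle (\<open>independent_family_exchange\<close>): the members of an independent family can be replaced
  one by one as long as each replacement avoids a given subspace. For the upper bound on the rank of \<open>Q + T\<close>, an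
  independent family of stacked vectors \<open>(a, b) = (a, 0) + (0, b)\<close> is split into its two halves;
  for the lower bound, vectors \<open>(a, 0)\<close> and \<open>(0, b)\<close> are replaced by vectors \<open>(a, s b)\<close> with
  \<open>s \<noteq> 0\<close>, and the scaling by \<open>s\<close> is absorbed by the free parameters. The passage between
  indeterminates and real parameter values uses that a set of columns of a generic matrix \<open>[I | T]\<close> is
  independent if and only if it can be matched to rows within the pattern.
  Since a full rank at one parameter value is a full rank at almost all of them
  (\<open>AE_full_rank\<close>, by Fubini along the lines through that value), there is one parameter value at
  which all maximal ranks \<open>r S\<close> are attained. There, \<open>M\<^sub>1\<close> consists of the sets of unit
  vectors that are independent modulo the column space of \<open>A\<close>.

  \<^emph>\<open>Controllability.\<close> Uniqueness of trajectories forces \<open>det (s F - A) \<noteq> 0\<close> for some real \<open>s\<close>, for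
  otherwise a nontrivial linear combination of \<open>n + 1\<close> exponential trajectories starts at \<open>0\<close>. If
  \<open>[z F - A | B]\<close> has rank \<open>n\<close> for all complex \<open>z\<close>, then linear combinations of the trajectories
  \<open>exp (\<sigma> t) w\<close> with \<open>(\<sigma> F - A) w = B h\<close> steer any consistent state to any other in time \<open>1\<close>: a functional
  \<open>(a, b)\<close> that vanishes on their pairs of values at \<open>0\<close> and \<open>1\<close> satisfies
  \<open>a \<bullet> w + exp \<sigma> * (b \<bullet> w) = 0\<close>, so \<open>a\<close> and \<open>b\<close> vanish on all \<open>w\<close> because
  \<open>exp\<close> is not rational, and by the rank condition a functional that vanishes on all \<open>w\<close> is mapped to \<open>0\<close>
  by a power of \<open>E = (s F - A)\<^sup>-\<^sup>1 F\<close>, acting from the right, and thus vanishes on all consistent states.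
  Conversely, a vector \<open>w \<noteq> 0\<close> with \<open>w A = 0\<close> and \<open>w B = 0\<close> makes \<open>w F x\<close> constant along all trajectories,
  whereas a polynomial trajectory starts at a state on which \<open>w F\<close> does not vanish.
\<close>

section \<open>Exchange in independent families of vectors\<close>

lemma (in vector_space) independent_family_insert:
  assumes "c \<notin> J"
  shows "(inj_on f (insert c J) \<and> independent (f ` insert c J)) \<longleftrightarrow>
         (inj_on f J \<and> independent (f ` J) \<and> f c \<notin> span (f ` J))"
proof -
  have "J - {c} = J" using assms by auto
  then show ?thesis
    using span_base[of "f c" "f ` J"] by (auto simp: independent_insert)
qed

text \<open>
  An independent family is given by an index set \<open>J\<close> and a map that is injective on \<open>J\<close> with
  independent image, as in the definition of a linear matroid. In the proof, the subspace \<open>W\<close> is the span of the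
  other, partly replaced, members.
\<close>

lemma (in vector_space) independent_family_exchange:
  assumes "finite J" and fam: "inj_on f J" "independent (f ` J)"
    and step: "\<And>c W. c \<in> J \<Longrightarrow> subspace W \<Longrightarrow> f c \<notin> W \<Longrightarrow> \<exists>y. y \<notin> W \<and> P c y"
  shows "\<exists>g. inj_on g J \<and> independent (g ` J) \<and> (\<forall>c\<in>J. P c (g c))"
proof -
  have "\<exists>g. inj_on g J \<and> independent (g ` J) \<and> (\<forall>c\<in>K. P c (g c)) \<and> (\<forall>c\<in>J - K. g c = f c)"
    if "finite K" "K \<subseteq> J" for K
    using that
  proof (induction K rule: finite_induct)
    case empty
    then show ?case using fam by (intro exI[of _ f]) auto
  next
    case (insert c K)
    then obtain g where g: "inj_on g J" "independent (g ` J)" "\<forall>c\<in>K. P c (g c)"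
      "\<forall>c\<in>J - K. g c = f c" by auto
    have J: "J = insert c (J - {c})" and c: "c \<in> J" "g c = f c" using insert g by auto
    have "inj_on g (J - {c}) \<and> independent (g ` (J - {c})) \<and> g c \<notin> span (g ` (J - {c}))"
      using g(1,2) J independent_family_insert[of c "J - {c}" g] by simp
    then have ind: "inj_on g (J - {c})" "independent (g ` (J - {c}))"
      and "f c \<notin> span (g ` (J - {c}))" using c by auto
    then obtain y where y: "y \<notin> span (g ` (J - {c}))" "P c y"
      using step[OF c(1) subspace_span] by blast
    let ?h = "g(c := y)"
    have im: "?h ` (J - {c}) = g ` (J - {c})" by auto
    have inj: "inj_on ?h (J - {c})" using ind(1) by (simp add: inj_on_def)
    have "inj_on ?h (insert c (J - {c})) \<and> independent (?h ` insert c (J - {c}))"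
      using ind(2) y(1) inj by (subst independent_family_insert) (simp_all only: im, auto)
    then have "inj_on ?h J \<and> independent (?h ` J)" using J by metis
    moreover have "\<forall>d\<in>insert c K. P d (?h d)" "\<forall>d\<in>J - insert c K. ?h d = f d"
      using g(3,4) y(2) insert.hyps by auto
    ultimately show ?case by blast
  qed
  from this[OF \<open>finite J\<close> order_refl] show ?thesis by auto
qed

lemma column_eq_sum_axis: "column c (M::'a::field^'c^'r) = (\<Sum>i\<in>UNIV. (M $ i $ c) *s axis i 1)"
  by (simp add: vec_eq_iff column_def axis_def if_distrib[of "\<lambda>x. _ * x"] cong: if_cong)

section \<open>Columns of matrices with generic entries\<close>

text \<open>
  A column is the sum of multiples of unit vectors. Replacing every column of an independent set
  by one of these unit vectors yields distinct unit vectors, that is, a matching of columns to rows.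
\<close>

lemma linear_matroid_transversal:
  fixes M :: "'a::field^'c^'r"
  assumes "J \<in> linear_matroid M"
  obtains \<phi> where "inj_on \<phi> J" "\<And>c. c \<in> J \<Longrightarrow> M $ \<phi> c $ c \<noteq> 0"
proof -
  have "\<exists>g. inj_on g J \<and> vec.independent (g ` J) \<and>
        (\<forall>c\<in>J. \<exists>i. M $ i $ c \<noteq> 0 \<and> g c = axis i (1::'a))"
  proof (rule vec.independent_family_exchange)
    show "inj_on (\<lambda>c. column c M) J" "vec.independent ((\<lambda>c. column c M) ` J)"
      using assms by (auto simp: linear_matroid_def)
  next
    fix c W assume W: "vec.subspace W" and c: "column c M \<notin> W"
    have "\<exists>i. (M $ i $ c) *s axis i (1::'a) \<notin> W"
      using c vec.subspace_sum[OF W, of UNIV "\<lambda>i. (M $ i $ c) *s axis i (1::'a)"]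
      unfolding column_eq_sum_axis by blast
    then obtain i where i: "(M $ i $ c) *s axis i (1::'a) \<notin> W" ..
    then have "axis i (1::'a) \<notin> W" "M $ i $ c \<noteq> 0"
      using vec.subspace_scale[OF W, of "axis i 1" "M $ i $ c"] vec.subspace_0[OF W] by auto
    then show "\<exists>y. y \<notin> W \<and> (\<exists>i. M $ i $ c \<noteq> 0 \<and> y = axis i 1)"
      by (intro exI[of _ "axis i 1"]) auto
  qed simp
  then obtain g where g: "inj_on g J" "\<forall>c\<in>J. \<exists>i. M $ i $ c \<noteq> 0 \<and> g c = axis i (1::'a)" by auto
  from bchoice[OF g(2)] obtain \<phi> where \<phi>: "\<And>c. c \<in> J \<Longrightarrow> M $ \<phi> c $ c \<noteq> 0 \<and> g c = axis (\<phi> c) 1" by auto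
  have "inj_on \<phi> J" using g(1) \<phi> by (metis inj_on_def)
  with \<phi> that show thesis by blast
qed

lemma column_eq_mult_axis:
  fixes A :: "'a::comm_ring_1^'m^'n"
  shows "column k A = A *v axis k 1"
  by (simp add: vec_eq_iff column_def matrix_vector_mult_def axis_def if_distrib[of "\<lambda>x. _ * x"] cong: if_cong)

lemma linear_matroid_invertible:
  fixes N :: "'a::field^'n^'n" and M :: "'a^'c^'n"
  assumes N: "det N \<noteq> 0" and \<phi>: "inj_on \<phi> J"
    and col: "\<And>c. c \<in> J \<Longrightarrow> column c M = column (\<phi> c) N"
  shows "J \<in> linear_matroid M"
proof -
  have inj: "inj ((*v) N)"
    using N invertible_det_nz[of N] inj_matrix_vector_mult by blast
  have "inj_on (\<lambda>c. N *v axis (\<phi> c) (1::'a)) J"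
  proof (rule inj_onI)
    fix c d assume "c \<in> J" "d \<in> J" "N *v axis (\<phi> c) (1::'a) = N *v axis (\<phi> d) 1"
    then have "axis (\<phi> c) (1::'a) = axis (\<phi> d) 1" using inj by (simp add: inj_eq)
    then show "c = d" using \<phi> \<open>c \<in> J\<close> \<open>d \<in> J\<close> by (simp add: axis_eq_axis inj_on_eq_iff)
  qed
  moreover have eq: "column c M = N *v axis (\<phi> c) 1" if "c \<in> J" for c
    using that col column_eq_mult_axis[of "\<phi> c" N] by simp
  ultimately have "inj_on (\<lambda>c. column c M) J" by (auto simp: inj_on_def)
  moreover have "vec.independent ((\<lambda>c. axis (\<phi> c) (1::'a)) ` J)"
    by (rule vec.independent_mono[OF independent_cart_basis]) (auto simp: cart_basis_def)
  then have "vec.independent ((*v) N ` (\<lambda>c. axis (\<phi> c) (1::'a)) ` J)"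
    by (rule vec.independent_injective_image) (use inj in \<open>auto intro: inj_on_subset matrix_vector_mul_linear_gen\<close>)
  then have "vec.independent ((\<lambda>c. column c M) ` J)"
    by (simp add: image_image eq cong: image_cong)
  ultimately show ?thesis by (simp add: linear_matroid_def)
qed

lemma linear_matroid_subset:
  "J \<in> linear_matroid M \<Longrightarrow> I \<subseteq> J \<Longrightarrow> I \<in> linear_matroid M"
  unfolding linear_matroid_def
  by (auto intro: inj_on_subset elim!: vec.independent_mono)

lemma det_ring_hom:
  fixes f :: "'a::comm_ring_1 \<Rightarrow> 'b::comm_ring_1" and A :: "'a^'n^'n"
  assumes add: "\<And>x y. f (x + y) = f x + f y" and mult: "\<And>x y. f (x * y) = f x * f y"
    and one: "f 1 = 1"
  shows "f (det A) = det (\<chi> i j. f (A $ i $ j))"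
proof -
  have zero: "f 0 = 0" using add[of 0 0] by simp
  have uminus: "f (- x) = - f x" for x
    using add[of x "- x"] zero by (simp add: eq_neg_iff_add_eq_0 add.commute)
  have sum: "f (sum g I) = (\<Sum>i\<in>I. f (g i))" for g :: "('n \<Rightarrow> 'n) \<Rightarrow> 'a" and I
    by (induction I rule: infinite_finite_induct) (auto simp: zero add)
  have prod: "f (prod g I) = (\<Prod>i\<in>I. f (g i))" for g :: "'n \<Rightarrow> 'a" and I
    by (induction I rule: infinite_finite_induct) (auto simp: one mult)
  have "f (of_int (sign p)) = of_int (sign p)" for p :: "'n \<Rightarrow> 'n"
    by (cases "evenperm p") (simp_all add: sign_def one uminus)
  then show ?thesis by (simp add: det_def sum mult prod)
qed

text \<open>
  The value of a polynomial when the indeterminates in \<open>U\<close> are set to \<open>1\<close> and all others to \<open>0\<close>: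
  a monomial survives if and only if all of its indeterminates belong to \<open>U\<close>.
\<close>

definition eval01 :: "nat set \<Rightarrow> ((nat \<Rightarrow>\<^sub>0 nat) \<Rightarrow>\<^sub>0 real) \<Rightarrow> real" where
  "eval01 U p = (\<Sum>m\<in>Poly_Mapping.keys p. if Poly_Mapping.keys m \<subseteq> U then Poly_Mapping.lookup p m else 0)"

lemma eval01_superset:
  assumes "finite K" "Poly_Mapping.keys p \<subseteq> K"
  shows "eval01 U p = (\<Sum>m\<in>K. if Poly_Mapping.keys m \<subseteq> U then Poly_Mapping.lookup p m else 0)"
  unfolding eval01_def by (rule sum.mono_neutral_left) (use assms in \<open>auto simp: in_keys_iff\<close>)

lemma eval01_add: "eval01 U (p + q) = eval01 U p + eval01 U q"
proof -
  have "Poly_Mapping.keys (p + q) \<subseteq> Poly_Mapping.keys p \<union> Poly_Mapping.keys q" by (rule keys_add)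
  then show ?thesis
    by (subst (1 2 3) eval01_superset[of "Poly_Mapping.keys p \<union> Poly_Mapping.keys q"])
      (auto simp: lookup_add sum.distrib[symmetric] intro!: sum.cong)
qed

lemma eval01_single: "eval01 U (Poly_Mapping.single m a) = (if Poly_Mapping.keys m \<subseteq> U then a else 0)"
  by (subst eval01_superset[of "{m}"]) auto

lemma eval01_sum: "eval01 U (sum f I) = (\<Sum>i\<in>I. eval01 U (f i))"
  by (induction I rule: infinite_finite_induct) (auto simp: eval01_add, simp_all add: eval01_def)

lemma sum_single_keys: "(\<Sum>m\<in>Poly_Mapping.keys p. Poly_Mapping.single m (Poly_Mapping.lookup p m)) = p"
  by (rule poly_mapping_eqI)
    (auto simp: lookup_sum lookup_single when_def in_keys_iff sum.delta' if_distrib cong: if_cong)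

lemma keys_add_nat: "Poly_Mapping.keys (m + m' :: nat \<Rightarrow>\<^sub>0 nat) = Poly_Mapping.keys m \<union> Poly_Mapping.keys m'"
  by (auto simp: in_keys_iff lookup_add)

lemma eval01_mult: "eval01 U (p * q) = eval01 U p * eval01 U q"
proof -
  have "p * q = (\<Sum>m\<in>Poly_Mapping.keys p. \<Sum>m'\<in>Poly_Mapping.keys q. Poly_Mapping.single (m + m') (Poly_Mapping.lookup p m * Poly_Mapping.lookup q m'))"
    by (subst (1) sum_single_keys[of p, symmetric], subst (1) sum_single_keys[of q, symmetric])
      (simp add: sum_product mult_single)
  then have "eval01 U (p * q) = (\<Sum>m\<in>Poly_Mapping.keys p. \<Sum>m'\<in>Poly_Mapping.keys q. 
       (if Poly_Mapping.keys m \<subseteq> U then Poly_Mapping.lookup p m else 0) * (if Poly_Mapping.keys m' \<subseteq> U then Poly_Mapping.lookup q m' else 0))"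
    by (auto simp: eval01_sum eval01_single keys_add_nat intro!: sum.cong)
  then show ?thesis by (simp add: eval01_def sum_product)
qed

lemma eval01_one: "eval01 U 1 = 1"
  using eval01_single[of U 0 1] by simp

text \<open>
  The rectangular version of a structure matrix: the entries of \<open>t\<close> at the positions in \<open>P\<close>, zeros elsewhere.
\<close>

definition fill :: "('r \<times> 'c) set \<Rightarrow> 'a::zero^'c^'r \<Rightarrow> 'a^'c^'r" where
  "fill P t = (\<chi> i j. if (i, j) \<in> P then t $ i $ j else 0)"

text \<open>
  The indeterminate with number \<open>k\<close>.
\<close>

definition var :: "nat \<Rightarrow> ratfun" where
  "var k = Fract (Poly_Mapping.single (Poly_Mapping.single k 1) 1) 1"

text \<open>
  The matrix whose entry at a position \<open>p\<close> is the indeterminate with number \<open>\<iota> p\<close>.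
\<close>

definition generic :: "('r \<times> 'c \<Rightarrow> nat) \<Rightarrow> ratfun^'c^'r" where
  "generic \<iota> = (\<chi> i j. var (\<iota> (i, j)))"

lemma column_hcat: "column (Inl j) (hcat A B) = column j A" "column (Inr k) (hcat A B) = column k B"
  by (simp_all add: column_def hcat_def vec_eq_iff)

lemma column_mat_one: "column i (mat 1) = axis i 1"
  by (auto simp: column_def mat_def axis_def vec_eq_iff)

text \<open>
  The matched columns are completed by unit vectors to a square matrix of polynomials.
  Setting the indeterminates at the matched positions to \<open>1\<close> and the others to \<open>0\<close> turns it into the identity
  matrix, hence its determinant is a nonzero polynomial.
\<close>

lemma generic_matching_independent:
  fixes \<iota> :: "'n::finite \<times> 'c::finite \<Rightarrow> nat" and J :: "('n + 'c) set"
  assumes \<iota>: "inj_on \<iota> P" and \<phi>: "inj_on \<phi> J"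
    and Inl: "\<And>i. Inl i \<in> J \<Longrightarrow> \<phi> (Inl i) = i"
    and Inr: "\<And>c. Inr c \<in> J \<Longrightarrow> (\<phi> (Inr c), c) \<in> P"
  shows "J \<in> linear_matroid (hcat (mat 1) (fill P (generic \<iota>)))"
proof -
  define e :: "'n \<Rightarrow> 'n + 'c \<Rightarrow> (nat \<Rightarrow>\<^sub>0 nat) \<Rightarrow>\<^sub>0 real" where
    "e i d = (case d of Inl k \<Rightarrow> if i = k then 1 else 0
       | Inr c \<Rightarrow> if (i, c) \<in> P then Poly_Mapping.single (Poly_Mapping.single (\<iota> (i, c)) 1) 1 else 0)" for i d
  define N where "N = (\<chi> i k. if k \<in> \<phi> ` J then e i (inv_into J \<phi> k) else if i = k then 1 else 0)"
  define U where "U = \<iota> ` {(\<phi> (Inr c), c) | c. Inr c \<in> J}"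
  have U: "\<iota> (i, c) \<in> U \<longleftrightarrow> i = \<phi> (Inr c)" if "Inr c \<in> J" "(i, c) \<in> P" for i c
    using that \<iota> Inr unfolding U_def inj_on_def by blast
  have ev0: "eval01 U 0 = 0" by (simp add: eval01_def)
  have ev: "eval01 U (e i d) = (if i = \<phi> d then 1 else 0)" if "d \<in> J" for i d
    using that Inl Inr U by (cases d) (auto simp: e_def eval01_one ev0 eval01_single)
  have "(\<chi> i j. eval01 U (N $ i $ j)) = mat 1"
    by (auto simp: N_def vec_eq_iff mat_def ev \<phi> eval01_one ev0)
  then have "eval01 U (det N) = 1"
    using det_ring_hom[of "eval01 U", OF eval01_add eval01_mult eval01_one, of N] by simp
  then have "det N \<noteq> 0" using ev0 by auto
  let ?F = "\<lambda>p :: (nat \<Rightarrow>\<^sub>0 nat) \<Rightarrow>\<^sub>0 real. Fract p 1"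
  have "?F (det N) = det (\<chi> i j. ?F (N $ i $ j))"
    by (rule det_ring_hom) (auto simp: One_fract_def)
  moreover have "?F (det N) \<noteq> 0"
    using \<open>det N \<noteq> 0\<close> by (simp add: Zero_fract_def eq_fract)
  ultimately have nz: "det (\<chi> i j. ?F (N $ i $ j)) \<noteq> 0" by simp
  show ?thesis
  proof (rule linear_matroid_invertible[OF nz \<phi>])
    fix d assume "d \<in> J"
    then show "column d (hcat (mat 1) (fill P (generic \<iota>))) = column (\<phi> d) (\<chi> i j. ?F (N $ i $ j))"
      using \<phi> by (cases d)
        (auto simp: column_def hcat_def fill_def generic_def N_def e_def mat_def var_def vec_eq_iff
          Zero_fract_def One_fract_def)
  qed
qed

lemma real_matching_independent:
  fixes J :: "('n::finite + 'c::finite) set"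
  assumes \<phi>: "inj_on \<phi> J"
    and Inl: "\<And>i. Inl i \<in> J \<Longrightarrow> \<phi> (Inl i) = i"
    and Inr: "\<And>c. Inr c \<in> J \<Longrightarrow> (\<phi> (Inr c), c) \<in> P"
  shows "J \<in> linear_matroid (hcat (mat 1) (fill P (\<chi> i c. if i = \<phi> (Inr c) then 1 else (0::real))))"
proof (rule linear_matroid_invertible[of "mat 1" _ J, OF _ \<phi>])
  fix d assume "d \<in> J"
  then show "column d (hcat (mat 1) (fill P (\<chi> i c. if i = \<phi> (Inr c) then 1 else (0::real)))) = column (\<phi> d) (mat 1)"
    using Inl Inr by (cases d) (auto simp: column_def hcat_def fill_def mat_def vec_eq_iff)
qed simp

lemma fill_matching:
  fixes t :: "'a::field^'c^'n"
  assumes "J \<in> linear_matroid (hcat (mat 1) (fill P t))"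
  obtains \<phi> where "inj_on \<phi> J" "\<And>i. Inl i \<in> J \<Longrightarrow> \<phi> (Inl i) = i"
    "\<And>c. Inr c \<in> J \<Longrightarrow> (\<phi> (Inr c), c) \<in> P"
proof -
  obtain \<phi> where \<phi>: "inj_on \<phi> J" "\<And>c. c \<in> J \<Longrightarrow> hcat (mat 1) (fill P t) $ \<phi> c $ c \<noteq> 0"
    using linear_matroid_transversal[OF assms] by blast
  have "\<phi> (Inl i) = i" if "Inl i \<in> J" for i
    using \<phi>(2)[OF that] by (simp add: hcat_def mat_def split: if_splits)
  moreover have "(\<phi> (Inr c), c) \<in> P" if "Inr c \<in> J" for c
    using \<phi>(2)[OF that] by (simp add: hcat_def fill_def split: if_splits)
  ultimately show thesis using \<phi>(1) that by blast
qed

text \<open>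
  Both sides say that \<open>J\<close> can be matched to rows within the pattern.
\<close>

lemma generic_independent_iff:
  fixes \<iota> :: "'n::finite \<times> 'c::finite \<Rightarrow> nat"
  assumes "inj_on \<iota> P"
  shows "J \<in> linear_matroid (hcat (mat 1) (fill P (generic \<iota>))) \<longleftrightarrow>
    (\<exists>t :: real^'c^'n. J \<in> linear_matroid (hcat (mat 1) (fill P t)))"
proof
  assume "J \<in> linear_matroid (hcat (mat 1) (fill P (generic \<iota>)))"
  then show "\<exists>t :: real^'c^'n. J \<in> linear_matroid (hcat (mat 1) (fill P t))"
    by (rule fill_matching) (blast intro: real_matching_independent)
next
  assume "\<exists>t :: real^'c^'n. J \<in> linear_matroid (hcat (mat 1) (fill P t))"
  then obtain t :: "real^'c^'n" where "J \<in> linear_matroid (hcat (mat 1) (fill P t))" ..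
  then show "J \<in> linear_matroid (hcat (mat 1) (fill P (generic \<iota>)))"
    by (rule fill_matching) (blast intro: generic_matching_independent[OF assms])
qed

section \<open>The rank of the union of two linear matroids\<close>

lemma independent_family_Pair_zero:
  "inj_on (\<lambda>j. (f j :: 'a::real_vector, 0 :: 'b::real_vector)) J \<and> independent ((\<lambda>j. (f j, 0::'b)) ` J)
    \<longleftrightarrow> inj_on f J \<and> independent (f ` J)"
  "inj_on (\<lambda>j. (0 :: 'b::real_vector, f j)) J \<and> independent ((\<lambda>j. (0::'b, f j)) ` J)
    \<longleftrightarrow> inj_on f J \<and> independent (f ` J)"
proof -
  have lin: "linear (\<lambda>x::'a. (x, 0::'b))" "linear (\<lambda>x::'a. (0::'b, x))"
    by (auto intro!: linearI)
  have 1: "dependent (f ` J)" if "dependent ((\<lambda>j. (f j, 0::'b)) ` J)"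
    using linear_independent_injective_image[OF lin(1), of "f ` J"] that
    by (auto simp: image_image inj_on_def)
  have 2: "dependent (f ` J)" if "dependent ((\<lambda>j. (0::'b, f j)) ` J)"
    using linear_independent_injective_image[OF lin(2), of "f ` J"] that
    by (auto simp: image_image inj_on_def)
  have 3: "independent (f ` J)" if "independent ((\<lambda>j. (f j, 0::'b)) ` J)"
  proof -
    have "span ((\<lambda>j. (f j, 0::'b)) ` J) \<subseteq> UNIV \<times> {0}"
      by (rule span_minimal) (auto intro: subspace_Times)
    then have "inj_on fst (span ((\<lambda>j. (f j, 0::'b)) ` J))" by (auto simp: inj_on_def)
    from linear_independent_injective_image[OF linear_fst that this] show ?thesis
      by (simp add: image_image)
  qed
  have 4: "independent (f ` J)" if "independent ((\<lambda>j. (0::'b, f j)) ` J)"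
  proof -
    have "span ((\<lambda>j. (0::'b, f j)) ` J) \<subseteq> {0} \<times> UNIV"
      by (rule span_minimal) (auto intro: subspace_Times)
    then have "inj_on snd (span ((\<lambda>j. (0::'b, f j)) ` J))" by (auto simp: inj_on_def)
    from linear_independent_injective_image[OF linear_snd that this] show ?thesis
      by (simp add: image_image)
  qed
  show "inj_on (\<lambda>j. (f j, 0 :: 'b)) J \<and> independent ((\<lambda>j. (f j, 0::'b)) ` J)
    \<longleftrightarrow> inj_on f J \<and> independent (f ` J)"
    using 1 3 by (auto simp: inj_on_def)
  show "inj_on (\<lambda>j. (0 :: 'b, f j)) J \<and> independent ((\<lambda>j. (0::'b, f j)) ` J)
    \<longleftrightarrow> inj_on f J \<and> independent (f ` J)"
    using 2 4 by (auto simp: inj_on_def)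
qed

lemma independent_Pair_Un:
  fixes A :: "'a::real_vector set" and B :: "'b::real_vector set"
  assumes A: "independent A" and B: "independent B"
  shows "independent (A \<times> {0} \<union> {0} \<times> B)"
  unfolding dependent_def
proof safe
  fix a assume a: "a \<in> A" "(a, 0) \<in> span (A \<times> {0} \<union> {0} \<times> B - {(a, 0)})"
  have "span (A \<times> {0} \<union> {0} \<times> B - {(a, 0)}) \<subseteq> span (A - {a}) \<times> UNIV"
    by (rule span_minimal) (auto intro: subspace_Times span_base span_zero)
  then show False using a A by (auto simp: dependent_def)
next
  fix b assume b: "b \<in> B" "(0, b) \<in> span (A \<times> {0} \<union> {0} \<times> B - {(0, b)})"
  have "span (A \<times> {0} \<union> {0} \<times> B - {(0, b)}) \<subseteq> UNIV \<times> span (B - {b})"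
    by (rule span_minimal) (auto intro: subspace_Times span_base span_zero)
  then show False using b B by (auto simp: dependent_def)
qed

lemma linear_matroid_real:
  fixes M :: "real^'c^'r"
  shows "J \<in> linear_matroid M \<longleftrightarrow> inj_on (\<lambda>j. column j M) J \<and> independent ((\<lambda>j. column j M) ` J)"
  by (simp add: linear_matroid_def dependent_vec_eq)

lemma sum_axis: "(\<Sum>i\<in>UNIV. x $ i *\<^sub>R axis i 1) = (x :: real^'n)"
  by (simp add: vec_eq_iff axis_def if_distrib[of "\<lambda>x. _ * x"] cong: if_cong)

text \<open>
  The columns of \<open>[I | Q]\<close> on top of the columns of \<open>[D | W]\<close>, where \<open>D\<close> is the diagonal matrix with entries \<open>s\<close>.
\<close>

definition stack :: "('n \<Rightarrow> real) \<Rightarrow> real^'c^'n \<Rightarrow> real^'c^'n \<Rightarrow> 'n + 'c \<Rightarrow> (real^'n) \<times> (real^'n)" where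
  "stack s Q W d = (case d of Inl i \<Rightarrow> (axis i 1, s i *\<^sub>R axis i 1) | Inr j \<Rightarrow> (column j Q, column j W))"

text \<open>
  With \<open>W = D (Q - R)\<close>, the stacked vectors are the images of the vectors \<open>(e\<^sub>i, 0)\<close> and
  \<open>(Q\<^sub>j, R\<^sub>j)\<close> under the automorphism \<open>(x, y) \<mapsto> (x, D (x - y))\<close>.
\<close>

lemma dim_stack:
  fixes Q R :: "real^'c^'n"
  assumes s: "\<And>i. s i \<noteq> 0"
  shows "dim (range (stack s Q (\<chi> i j. s i * (Q - R) $ i $ j))) = CARD('n) + rank R"
proof -
  define G where "G = (\<lambda>p::(real^'n) \<times> (real^'n). (fst p, \<chi> i. s i * (fst p - snd p) $ i))"
  have "linear G"
    by (rule linearI) (auto simp: G_def vec_eq_iff algebra_simps)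
  have "inj G" using s by (auto simp: G_def inj_def vec_eq_iff)
  let ?v = "\<lambda>d::'n + 'c. case d of Inl i \<Rightarrow> (axis i (1::real), 0::real^'n) | Inr j \<Rightarrow> (column j Q, column j R)"
  have "stack s Q (\<chi> i j. s i * (Q - R) $ i $ j) = G \<circ> ?v"
    by (auto simp: fun_eq_iff stack_def G_def column_def axis_def vec_eq_iff split: sum.split)
  then have "dim (range (stack s Q (\<chi> i j. s i * (Q - R) $ i $ j))) = dim (G ` range ?v)"
    by (simp add: image_comp)
  also have "\<dots> = dim (range ?v)"
    by (rule dim_image_eq[OF \<open>linear G\<close>]) (use \<open>inj G\<close> in \<open>auto intro: inj_on_subset\<close>)
  also have "\<dots> = dim (span (range ?v))" by simp
  also have "span (range ?v) = UNIV \<times> span (columns R)"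
  proof (rule antisym)
    show "span (range ?v) \<subseteq> UNIV \<times> span (columns R)"
    proof (rule span_minimal)
      have "?v d \<in> UNIV \<times> span (columns R)" for d
        by (cases d) (auto intro!: span_base span_zero simp: columns_def)
      then show "range ?v \<subseteq> UNIV \<times> span (columns R)" by blast
    qed (simp add: subspace_Times)
    have 1: "(x, 0) \<in> span (range ?v)" for x
    proof -
      have "(\<Sum>i\<in>UNIV. (x $ i) *\<^sub>R ?v (Inl i)) \<in> span (range ?v)"
        by (intro span_sum span_scale span_base) blast
      also have "(\<Sum>i\<in>UNIV. (x $ i) *\<^sub>R ?v (Inl i)) = (x, 0)"
        by (simp add: prod_eq_iff fst_sum snd_sum sum_axis)
      finally show ?thesis .
    qed
    have "columns R \<subseteq> {y. (0, y) \<in> span (range ?v)}"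
    proof (clarsimp simp: columns_def)
      fix j
      have "?v (Inr j) - (column j Q, 0) \<in> span (range ?v)"
        by (intro span_diff span_base 1) blast
      then show "(0, column j R) \<in> span (range ?v)" by simp
    qed
    moreover have "subspace {y. (0, y) \<in> span (range ?v)}"
      using span_add[of "(0, _)" "range ?v" "(0, _)"] span_scale[of "(0, _)" "range ?v"]
        span_zero[of "range ?v"]
      unfolding subspace_def zero_prod_def by force
    ultimately have "span (columns R) \<subseteq> {y. (0, y) \<in> span (range ?v)}" by (rule span_minimal)
    then show "UNIV \<times> span (columns R) \<subseteq> span (range ?v)"
    proof (clarify, goal_cases)
      case (1 x y)
      then have "(x, 0) + (0, y) \<in> span (range ?v)"
        using \<open>\<And>x. (x, 0) \<in> span (range ?v)\<close> by (intro span_add) auto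
      then show ?case by simp
    qed
  qed
  also have "dim ((UNIV :: (real^'n) set) \<times> span (columns R)) = CARD('n) + rank R"
    using dim_Times[of "UNIV :: (real^'n) set" "span (columns R)"] by (simp add: column_rank_def)
  finally show ?thesis .
qed

lemma stack_eq_columns:
  "stack (\<lambda>i. 1) Q W = (\<lambda>d. (column d (hcat (mat 1) Q), column d (hcat (mat 1) W)))"
  by (auto simp: stack_def fun_eq_iff column_hcat column_mat_one split: sum.split)

lemma card_le_matroid_rank: "I \<in> M \<Longrightarrow> card I \<le> matroid_rank M"
  by (simp add: matroid_rank_def)

lemma empty_in_linear_matroid: "{} \<in> linear_matroid M"
  by (simp add: linear_matroid_def vec.independent_empty)

lemma independent_family_card_dim:
  fixes v :: "'d \<Rightarrow> 'e::euclidean_space"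
  obtains J where "inj_on v J" "independent (v ` J)" "card J = dim (range v)"
proof -
  obtain B where B: "B \<subseteq> range v" "independent B" "card B = dim (range v)"
    using basis_exists[of "range v"] by metis
  then obtain J where "inj_on v J" "B = v ` J" by (auto simp: subset_image_inj)
  then show thesis using that[of J] B by (metis card_image)
qed

text \<open>
  The columns of \<open>[I | Q]\<close> on top of those of \<open>[I | -T]\<close> span a space of dimension \<open>n + rank (Q + T)\<close>.
  A basis among them splits into a part whose upper halves are independent and a part whose lower halves are.
\<close>

lemma rank_le_rank_matroid_union:
  fixes Q :: "real^'c^'n" and t :: "real^'c^'n" and \<iota> :: "'n::finite \<times> 'c::finite \<Rightarrow> nat"
  assumes \<iota>: "inj_on \<iota> P"
  shows "CARD('n) + rank (Q + fill P t) \<le> matroid_rank (matroid_union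
    (linear_matroid (hcat (mat 1) Q)) (linear_matroid (hcat (mat 1) (fill P (generic \<iota>)))))"
proof -
  let ?a = "\<lambda>d. column d (hcat (mat 1) Q)"
  let ?b = "\<lambda>d. column d (hcat (mat 1) (fill P (- t)))"
  let ?v = "\<lambda>d. (?a d, ?b d)"
  have veq: "?v = stack (\<lambda>i. 1) Q (\<chi> i j. 1 * (Q - (Q + fill P t)) $ i $ j)"
    by (simp add: stack_eq_columns fun_eq_iff) (auto simp: column_def hcat_def fill_def vec_eq_iff split: sum.split)
  then have dim: "dim (range ?v) = CARD('n) + rank (Q + fill P t)"
    using dim_stack[of "\<lambda>i. 1" Q "Q + fill P t"] unfolding veq by auto
  obtain J where J: "inj_on ?v J" "independent (?v ` J)" "card J = dim (range ?v)"
    using independent_family_card_dim[of ?v] by blast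
  \<comment> \<open>a subspace that contains both halves of a stacked vector contains the vector\<close>
  have "\<exists>g. inj_on g J \<and> independent (g ` J) \<and> (\<forall>d\<in>J. g d = (?a d, 0) \<or> g d = (0, ?b d))"
  proof (rule real_vector.independent_family_exchange[OF _ J(1,2)])
    fix d W assume W: "subspace W" and d: "?v d \<notin> W"
    have "?v d = (?a d, 0) + (0, ?b d)" by simp
    then have "(?a d, 0) \<notin> W \<or> (0, ?b d) \<notin> W" using d subspace_add[OF W] by metis
    then show "\<exists>y. y \<notin> W \<and> (y = (?a d, 0) \<or> y = (0, ?b d))" by blast
  qed simp
  then obtain g where g: "inj_on g J" "independent (g ` J)"
    "\<And>d. d \<in> J \<Longrightarrow> g d = (?a d, 0) \<or> g d = (0, ?b d)" by blast
  define I where "I = {d\<in>J. g d = (?a d, 0)}"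
  have "inj_on (\<lambda>d. (?a d, 0::real^'n)) I \<longleftrightarrow> inj_on g I"
    by (rule inj_on_cong) (simp add: I_def)
  moreover have "(\<lambda>d. (?a d, 0::real^'n)) ` I = g ` I"
    by (rule image_cong) (simp_all add: I_def)
  moreover have "inj_on g I" "independent (g ` I)"
    using inj_on_subset[OF g(1), of I] independent_mono[OF g(2) image_mono, of I]
    by (simp_all add: I_def)
  ultimately have I: "I \<in> linear_matroid (hcat (mat 1) Q)"
    unfolding linear_matroid_real by (subst independent_family_Pair_zero(1)[symmetric, where 'b = "real^'n"]) simp
  have gK: "g d = (0, ?b d)" if "d \<in> J - I" for d
    using g(3)[of d] that by (auto simp: I_def)
  have "inj_on (\<lambda>d. (0::real^'n, ?b d)) (J - I) \<longleftrightarrow> inj_on g (J - I)"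
    by (rule inj_on_cong) (simp add: gK)
  moreover have "(\<lambda>d. (0::real^'n, ?b d)) ` (J - I) = g ` (J - I)"
    by (rule image_cong) (simp_all add: gK)
  moreover have "inj_on g (J - I)" "independent (g ` (J - I))"
    using inj_on_subset[OF g(1), of "J - I"] independent_mono[OF g(2) image_mono, of "J - I"]
    by simp_all
  ultimately have "J - I \<in> linear_matroid (hcat (mat 1) (fill P (- t)))"
    unfolding linear_matroid_real by (subst independent_family_Pair_zero(2)[symmetric, where 'b = "real^'n"]) simp
  then have "J - I \<in> linear_matroid (hcat (mat 1) (fill P (generic \<iota>)))"
    using generic_independent_iff[OF \<iota>] by blast
  with I have "I \<union> (J - I) \<in> matroid_union
    (linear_matroid (hcat (mat 1) Q)) (linear_matroid (hcat (mat 1) (fill P (generic \<iota>))))"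
    unfolding matroid_union_def by blast
  moreover have "I \<union> (J - I) = J" by (auto simp: I_def)
  ultimately show ?thesis using card_le_matroid_rank[of J] dim J(3) by simp
qed

text \<open>
  Together with \<open>rank_le_rank_matroid_union\<close>, the rank of the union is \<open>n\<close> plus the maximum of the ranks of
  \<open>Q + T\<close> over all real values of the free parameters.
\<close>

lemma rank_matroid_union_attained:
  fixes Q :: "real^'c^'n" and \<iota> :: "'n::finite \<times> 'c::finite \<Rightarrow> nat"
  assumes \<iota>: "inj_on \<iota> P"
  shows "\<exists>t :: real^'c^'n. matroid_rank (matroid_union
    (linear_matroid (hcat (mat 1) Q)) (linear_matroid (hcat (mat 1) (fill P (generic \<iota>)))))
    \<le> CARD('n) + rank (Q + fill P t)"
proof -
  let ?U = "matroid_union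
    (linear_matroid (hcat (mat 1) Q)) (linear_matroid (hcat (mat 1) (fill P (generic \<iota>))))"
  have "{} \<in> ?U"
    unfolding matroid_union_def mem_Collect_eq
    by (intro exI[of _ "{}"]) (simp add: empty_in_linear_matroid)
  then have "matroid_rank ?U \<in> card ` ?U"
    unfolding matroid_rank_def by (intro Max_in) auto
  then obtain I K where I: "I \<in> linear_matroid (hcat (mat 1) Q)"
    and K: "K \<in> linear_matroid (hcat (mat 1) (fill P (generic \<iota>)))"
    and card: "matroid_rank ?U = card (I \<union> K)"
    unfolding matroid_union_def by auto
  define K' where "K' = K - I"
  have "K' \<in> linear_matroid (hcat (mat 1) (fill P (generic \<iota>)))"
    using K by (rule linear_matroid_subset) (auto simp: K'_def)
  then obtain t :: "real^'c^'n" where K': "K' \<in> linear_matroid (hcat (mat 1) (fill P t))"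
    using generic_independent_iff[OF \<iota>] by blast
  define a where "a = (\<lambda>d. column d (hcat (mat 1) Q))"
  define b where "b = (\<lambda>d. column d (hcat (mat 1) (fill P t)))"
  let ?J = "I \<union> K'"
  let ?f = "\<lambda>d. if d \<in> I then (a d, 0) else (0, b d)"
  have a: "inj_on a I" "independent (a ` I)" and b: "inj_on b K'" "independent (b ` K')"
    using I K' by (simp_all add: linear_matroid_real a_def b_def)
  have "0 \<notin> a ` I" by (rule contrapos_nn[OF a(2) dependent_zero])
  then have "inj_on ?f ?J"
    using a(1) b(1) unfolding inj_on_def image_iff by (auto split: if_splits)
  moreover have "?f ` ?J = (a ` I) \<times> {0} \<union> {0} \<times> (b ` K')"
    by (auto simp: K'_def)
  then have "independent (?f ` ?J)" using independent_Pair_Un[OF a(2) b(2)] by simp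
  ultimately have "\<exists>g. inj_on g ?J \<and> independent (g ` ?J) \<and>
      (\<forall>d\<in>?J. \<exists>s. s \<noteq> 0 \<and> g d = (a d, s *\<^sub>R b d))"
  proof (rule real_vector.independent_family_exchange[rotated])
    fix d W assume W: "subspace W" and d: "?f d \<notin> W"
    \<comment> \<open>two different scalings suffice: a subspace that contains both vectors contains both halves\<close>
    have "(a d, 1 *\<^sub>R b d) \<notin> W \<or> (a d, 2 *\<^sub>R b d) \<notin> W"
    proof (rule ccontr)
      assume "\<not> ?thesis"
      then have 1: "(a d, 1 *\<^sub>R b d) \<in> W" and 2: "(a d, 2 *\<^sub>R b d) \<in> W" by auto
      have "(0, b d) \<in> W" using subspace_diff[OF W 2 1] by (simp add: scaleR_2)
      moreover from this have "(a d, 0) \<in> W" using subspace_diff[OF W 1] by fastforce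
      ultimately show False using d by (auto split: if_splits)
    qed
    then show "\<exists>y. y \<notin> W \<and> (\<exists>s. s \<noteq> 0 \<and> y = (a d, s *\<^sub>R b d))"
      by (metis one_neq_zero zero_neq_numeral)
  qed simp
  then obtain g where g: "inj_on g ?J" "independent (g ` ?J)"
    "\<forall>d\<in>?J. \<exists>s. s \<noteq> 0 \<and> g d = (a d, s *\<^sub>R b d)" by blast
  from bchoice[OF g(3)] obtain r where r: "\<And>d. d \<in> ?J \<Longrightarrow> r d \<noteq> 0 \<and> g d = (a d, r d *\<^sub>R b d)" by blast
  define s where "s = (\<lambda>d. if d \<in> ?J then r d else 1)"
  have s: "s d \<noteq> 0" for d using r by (simp add: s_def)
  \<comment> \<open>the scalings of rows and columns only change the values of the free parameters\<close>
  define t' where "t' = (\<chi> i j. - (t $ i $ j * s (Inr j) / s (Inl i)))"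
  let ?R = "Q + fill P t'"
  let ?v = "stack (\<lambda>i. s (Inl i)) Q (\<chi> i j. s (Inl i) * (Q - ?R) $ i $ j)"
  have v: "?v d = (a d, s d *\<^sub>R b d)" for d
    using s by (cases d) (auto simp: a_def b_def stack_def column_hcat column_mat_one,
        auto simp: column_def fill_def t'_def vec_eq_iff)
  have "card ?J = card (g ` ?J)" using g(1) by (simp add: card_image)
  also have "\<dots> = dim (g ` ?J)" using g(2) by (simp add: dim_eq_card_independent)
  also have "\<dots> \<le> dim (range ?v)"
  proof (rule dim_subset)
    have "g d = ?v d" if "d \<in> ?J" for d using r[OF that] that v[of d] by (simp add: s_def)
    then show "g ` ?J \<subseteq> range ?v" by blast
  qed
  also have "\<dots> = CARD('n) + rank ?R" by (rule dim_stack) (rule s)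
  finally have "card ?J \<le> CARD('n) + rank ?R" .
  moreover have "?J = I \<union> K" by (auto simp: K'_def)
  ultimately show ?thesis using card by auto
qed

section \<open>Full rank for almost all parameter values\<close>

text \<open>
  For every \<open>x\<close>, the value \<open>f (a + c (x - a))\<close> is nonzero for almost all \<open>c\<close>, because a nonzero polynomial in one
  variable has finitely many roots. By Fubini's theorem, there is a \<open>c \<noteq> 0\<close> such that it is nonzero for
  almost all \<open>x\<close>, and the dilation with factor \<open>c\<close> preserves null sets.
\<close>

lemma AE_nonzero_if_polynomial_on_lines:
  fixes f :: "'a::euclidean_space \<Rightarrow> real"
  assumes cont: "continuous_on UNIV f" and a: "f a \<noteq> 0"
    and line: "\<And>x. \<exists>p. \<forall>c. f (a + c *\<^sub>R (x - a)) = poly p c"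
  shows "AE x in lborel. f x \<noteq> 0"
proof -
  have f[measurable]: "f \<in> borel_measurable borel"
    using cont by (rule borel_measurable_continuous_onI)
  have "AE x in lborel. AE c in lborel. f (a + c *\<^sub>R (x - a)) \<noteq> 0"
  proof (rule AE_I2)
    fix x
    obtain p where p: "\<And>c. f (a + c *\<^sub>R (x - a)) = poly p c" using line by blast
    have "p \<noteq> 0" using p[of 0] a by auto
    then have "{c. poly p c = 0} \<in> null_sets lborel"
      by (intro countable_imp_null_set_lborel countable_finite poly_roots_finite)
    from AE_not_in[OF this] show "AE c in lborel. f (a + c *\<^sub>R (x - a)) \<noteq> 0" by (simp add: p)
  qed
  moreover have "{p \<in> space (lborel \<Otimes>\<^sub>M lborel). f (a + snd p *\<^sub>R (fst p - a)) \<noteq> 0} \<in> sets ((lborel :: 'a measure) \<Otimes>\<^sub>M (lborel :: real measure))"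
    by measurable
  ultimately have "AE c in lborel. AE x in lborel. f (a + c *\<^sub>R (x - a)) \<noteq> 0"
    using pair_sigma_finite.AE_commute[OF lborel_pair.pair_sigma_finite_axioms, of "\<lambda>x c. f (a + c *\<^sub>R (x - a)) \<noteq> 0"] by simp
  moreover have "AE c in lborel. c \<noteq> (0::real)" by (rule AE_lborel_singleton)
  ultimately have "AE c in lborel. c \<noteq> 0 \<and> (AE x in lborel. f (a + c *\<^sub>R (x - a)) \<noteq> 0)"
    by eventually_elim simp
  moreover have "ae_filter (lborel :: real measure) \<noteq> bot"
    by (simp add: ae_filter_eq_bot_iff)
  ultimately obtain c where c: "c \<noteq> 0" and AE: "AE x in lborel. f (a + c *\<^sub>R (x - a)) \<noteq> 0"
    using eventually_happens' by blast
  let ?t = "a - c *\<^sub>R a"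
  have "AE x in lborel. f (?t + c *\<^sub>R x) \<noteq> 0"
    using AE by (simp add: algebra_simps)
  then have "AE x in distr lborel borel (\<lambda>x. ?t + c *\<^sub>R x). f x \<noteq> 0"
    by (subst AE_distr_iff) simp_all
  then have "AE x in density (distr lborel borel (\<lambda>x. ?t + c *\<^sub>R x)) (\<lambda>_. \<bar>c\<bar> ^ DIM('a)). f x \<noteq> 0"
    by (subst AE_density) (auto elim: eventually_mono)
  then show ?thesis by (subst lborel_affine[OF c, of ?t])
qed

text \<open>
  A right inverse \<open>C\<close> of \<open>M a\<close> gives the function \<open>x \<mapsto> det (M x ** C)\<close>, which is \<open>1\<close> at \<open>a\<close>
  and polynomial on lines.
\<close>

lemma AE_full_rank:
  fixes M :: "'a::euclidean_space \<Rightarrow> real^'c^'n"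
  assumes cont: "\<And>i j. continuous_on UNIV (\<lambda>x. M x $ i $ j)"
    and affine: "\<And>x c. M (a + c *\<^sub>R (x - a)) = M a + c *\<^sub>R (M x - M a)"
    and a: "rank (M a) = CARD('n)"
  shows "AE x in lborel. rank (M x) = CARD('n)"
proof -
  obtain C where C: "M a ** C = mat 1"
    using a by (auto simp: full_rank_surjective matrix_right_invertible_surjective[symmetric])
  have "AE x in lborel. det (M x ** C) \<noteq> 0"
  proof (rule AE_nonzero_if_polynomial_on_lines)
    show "continuous_on UNIV (\<lambda>x. det (M x ** C))"
      unfolding det_def matrix_matrix_mult_def by (auto intro!: continuous_intros cont)
    show "det (M a ** C) \<noteq> 0" by (simp add: C)
    fix x
    define N where "N = (\<chi> i j. [: (M a ** C) $ i $ j, (M x ** C - M a ** C) $ i $ j :])"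
    have "det (M (a + c *\<^sub>R (x - a)) ** C) = poly (det N) c" for c
    proof -
      have "M (a + c *\<^sub>R (x - a)) ** C = (\<chi> i j. poly (N $ i $ j) c)"
        unfolding affine by (simp add: N_def vec_eq_iff matrix_matrix_mult_def sum_distrib_left
            sum_subtractf[symmetric] sum.distrib[symmetric] algebra_simps)
      then show ?thesis using det_ring_hom[of "\<lambda>p. poly p c" N] by simp
    qed
    then show "\<exists>p. \<forall>c. det (M (a + c *\<^sub>R (x - a)) ** C) = poly p c" by blast
  qed
  then show ?thesis
  proof eventually_elim
    case (elim x)
    then have "invertible (M x ** C)" by (simp add: invertible_det_nz)
    then obtain D where "M x ** C ** D = mat 1" by (auto simp: invertible_def)
    then have "\<exists>D. M x ** D = mat 1" by (auto simp: matrix_mul_assoc[symmetric])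
    then show ?case by (simp add: full_rank_surjective matrix_right_invertible_surjective[symmetric])
  qed
qed

section \<open>Vectors that are independent modulo a subspace\<close>

lemma dim_insert_family:
  fixes V :: "'a::euclidean_space set"
  shows "dim (V \<union> e ` insert i S) = (if e i \<in> span (V \<union> e ` S) then dim (V \<union> e ` S) else Suc (dim (V \<union> e ` S)))"
  using dim_insert[of "e i" "V \<union> e ` S"] by simp

lemma independent_modulo_basis:
  fixes V :: "'a::euclidean_space set"
  assumes "finite S"
  obtains X where "X \<subseteq> S" "dim (V \<union> e ` X) = dim V + card X" "dim (V \<union> e ` X) = dim (V \<union> e ` S)"
proof -
  have "\<exists>X\<subseteq>S. dim (V \<union> e ` X) = dim V + card X \<and> e ` S \<subseteq> span (V \<union> e ` X)"
    using assms
  proof (induction S rule: finite_induct)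
    case (insert i S)
    then obtain X where X: "X \<subseteq> S" "dim (V \<union> e ` X) = dim V + card X" "e ` S \<subseteq> span (V \<union> e ` X)"
      by blast
    show ?case
    proof (cases "e i \<in> span (V \<union> e ` X)")
      case True
      then show ?thesis using X by (intro exI[of _ X]) auto
    next
      case False
      have "finite X" "i \<notin> X" using X(1) insert.hyps finite_subset by auto
      then have "dim (V \<union> e ` insert i X) = dim V + card (insert i X)"
        using X(2) False by (subst dim_insert_family) simp
      moreover have "e ` insert i S \<subseteq> span (V \<union> e ` insert i X)"
        using X(3) span_mono[of "V \<union> e ` X" "V \<union> e ` insert i X"] by (auto intro: span_base)
      ultimately show ?thesis using X(1) by (intro exI[of _ "insert i X"]) auto
    qed
  qed auto
  then obtain X where X: "X \<subseteq> S" "dim (V \<union> e ` X) = dim V + card X" "e ` S \<subseteq> span (V \<union> e ` X)"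
    by blast
  have "V \<union> e ` S \<subseteq> span (V \<union> e ` X)" using X(3) by (auto intro: span_base)
  then have "dim (V \<union> e ` S) \<le> dim (V \<union> e ` X)" by (metis dim_span dim_subset)
  moreover have "dim (V \<union> e ` X) \<le> dim (V \<union> e ` S)" by (rule dim_subset) (use X(1) in auto)
  ultimately show thesis using that X by simp
qed

lemma dim_union_le_card:
  fixes V :: "'a::euclidean_space set"
  assumes "finite S"
  shows "dim (V \<union> e ` (T \<union> S)) \<le> dim (V \<union> e ` T) + card S"
  using assms
proof (induction S rule: finite_induct)
  case (insert i S)
  have "dim (V \<union> e ` insert i (T \<union> S)) \<le> Suc (dim (V \<union> e ` (T \<union> S)))"
    by (subst dim_insert_family) simp
  then show ?case using insert by simp
qed simp

text \<open>
  The sets of indices of vectors \<open>e i\<close> that are independent modulo the span of \<open>V\<close> form a matroid, and its dual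
  consists of the sets that are disjoint from some completion of \<open>V\<close> to a spanning set.
\<close>

lemma dual_matroid_contraction:
  fixes V :: "'a::euclidean_space set" and e :: "'n::finite \<Rightarrow> 'a"
  assumes M: "M = {X. dim (V \<union> e ` X) = dim V + card X}"
    and spanning: "span (V \<union> range e) = UNIV"
  shows "R \<in> dual_matroid M \<longleftrightarrow> dim (V \<union> e ` (UNIV - R)) = DIM('a)"
proof
  assume "R \<in> dual_matroid M"
  then obtain B where B: "dim (V \<union> e ` B) = dim V + card B" "R \<inter> B = {}"
    and max: "\<And>I. dim (V \<union> e ` I) = dim V + card I \<Longrightarrow> B \<subseteq> I \<Longrightarrow> I = B"
    by (auto simp: dual_matroid_def matroid_basis_def M)
  have "e i \<in> span (V \<union> e ` B)" for i
  proof (rule ccontr)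
    assume i: "e i \<notin> span (V \<union> e ` B)"
    then have "i \<notin> B" by (auto intro: span_base)
    then have "dim (V \<union> e ` insert i B) = dim V + card (insert i B)"
      using i B by (subst dim_insert_family) simp
    from max[OF this] \<open>i \<notin> B\<close> show False by blast
  qed
  then have "V \<union> range e \<subseteq> span (V \<union> e ` B)" by (auto intro: span_base)
  then have "span (V \<union> e ` B) = UNIV" using spanning span_minimal[OF _ subspace_span] by blast
  then have "dim (V \<union> e ` B) = DIM('a)" by (simp add: dim_eq_full)
  moreover have "dim (V \<union> e ` B) \<le> dim (V \<union> e ` (UNIV - R))" by (rule dim_subset) (use B(2) in auto)
  ultimately show "dim (V \<union> e ` (UNIV - R)) = DIM('a)"
    using dim_subset_UNIV[of "V \<union> e ` (UNIV - R)"] by simp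
next
  assume R: "dim (V \<union> e ` (UNIV - R)) = DIM('a)"
  obtain X where X: "X \<subseteq> UNIV - R" "dim (V \<union> e ` X) = dim V + card X" "dim (V \<union> e ` X) = DIM('a)"
    using independent_modulo_basis[of "UNIV - R" V e] R by auto
  have "I = X" if "dim (V \<union> e ` I) = dim V + card I" "X \<subseteq> I" for I
  proof -
    have "card I \<le> card X" using that(1) X(2,3) dim_subset_UNIV[of "V \<union> e ` I"] by simp
    then show ?thesis using that(2) by (metis card_seteq finite)
  qed
  then have "matroid_basis M X" using X(2) by (auto simp: matroid_basis_def M)
  then show "R \<in> dual_matroid M" using X(1) by (auto simp: dual_matroid_def)
qed

lemma minimal_completion_card_le:
  fixes V :: "'a::euclidean_space set" and e :: "'n::finite \<Rightarrow> 'a"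
  assumes S: "dim (V \<union> e ` S) = DIM('a)"
    and minimal: "\<And>i. i \<in> S \<Longrightarrow> dim (V \<union> e ` (S - {i})) \<noteq> DIM('a)"
    and S': "dim (V \<union> e ` S') = DIM('a)"
  shows "card S \<le> card S'"
proof -
  obtain X where X: "X \<subseteq> S" "dim (V \<union> e ` X) = dim V + card X" "dim (V \<union> e ` X) = DIM('a)"
    using independent_modulo_basis[of S V e] S by auto
  have "X = S"
  proof (rule ccontr)
    assume "X \<noteq> S"
    then obtain i where i: "i \<in> S" "i \<notin> X" using X(1) by blast
    then have "dim (V \<union> e ` X) \<le> dim (V \<union> e ` (S - {i}))" using X(1) by (intro dim_subset) auto
    then show False using X(3) minimal[OF i(1)] dim_subset_UNIV[of "V \<union> e ` (S - {i})"] by simp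
  qed
  obtain X' where X': "X' \<subseteq> S'" "dim (V \<union> e ` X') = dim V + card X'" "dim (V \<union> e ` X') = DIM('a)"
    using independent_modulo_basis[of S' V e] S' by auto
  have "card S = card X'" using X X' \<open>X = S\<close> by simp
  then show ?thesis using X'(1) by (simp add: card_mono)
qed

section \<open>The greedy algorithm\<close>

lemma num_queries_greedy_loop: "num_queries orc (greedy_loop vs R) = length vs"
  by (induction vs arbitrary: R) simp_all

lemma greedy_loop_maximal:
  assumes down: "\<And>R R'. R \<subseteq> R' \<Longrightarrow> orc R' \<Longrightarrow> orc R" and "orc R"
  shows "R \<subseteq> run_prog orc (greedy_loop vs R) \<and> orc (run_prog orc (greedy_loop vs R)) \<and>
    (\<forall>i\<in>set vs - run_prog orc (greedy_loop vs R). \<not> orc (insert i (run_prog orc (greedy_loop vs R))))"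
  using \<open>orc R\<close>
proof (induction vs arbitrary: R)
  case (Cons v vs)
  let ?R = "if orc (insert v R) then insert v R else R"
  let ?G = "run_prog orc (greedy_loop vs ?R)"
  have IH: "?R \<subseteq> ?G" "orc ?G" "\<forall>i\<in>set vs - ?G. \<not> orc (insert i ?G)"
    using Cons.IH[of ?R] Cons.prems by auto
  moreover have "\<not> orc (insert v ?G)" if "v \<notin> ?G"
  proof
    assume "orc (insert v ?G)"
    moreover have "insert v R \<subseteq> insert v ?G" using IH(1) by (auto split: if_splits)
    ultimately have "orc (insert v R)" using down by blast
    then show False using IH(1) that by auto
  qed
  moreover have "R \<subseteq> ?G" using IH(1) by (auto split: if_splits)
  ultimately show ?case by (auto simp del: if_split)
qed simp

section \<open>The generic rank of the controlled system and its matroid\<close>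

text \<open>
  The matrix \<open>[A | T\<^sub>B(S)]\<close> at the parameter values \<open>\<theta>\<close>.
\<close>

definition controlled_mat ::
    "real^'n^'n \<Rightarrow> ('n \<times> 'n) set \<Rightarrow> 'n::finite set \<Rightarrow> 'n params \<Rightarrow> real^('n + 'n)^'n" where
  "controlled_mat QA PA S \<theta> = hcat (A_at QA PA \<theta>) (B_at S \<theta>)"

lemma controlled_mat_nth:
  "controlled_mat QA PA S \<theta> $ i $ Inl j = QA $ i $ j + (if (i, j) \<in> PA then fst (snd \<theta>) $ i $ j else 0)"
  "controlled_mat QA PA S \<theta> $ i $ Inr j = (if i = j \<and> i \<in> S then snd (snd \<theta>) $ i else 0)"
  by (simp_all add: controlled_mat_def hcat_def A_at_def B_at_def struct_mat_def input_mat_def)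

lemma AE_full_rank_controlled_mat:
  fixes QA :: "real^'n^'n"
  assumes "rank (controlled_mat QA PA S \<theta>) = CARD('n)"
  shows "AE \<theta> in lborel. rank (controlled_mat QA PA S \<theta>) = CARD('n)"
proof (rule AE_full_rank[where M = "controlled_mat QA PA S", OF _ _ assms])
  show "continuous_on UNIV (\<lambda>\<theta>. controlled_mat QA PA S \<theta> $ i $ j)" for i j
    by (cases j; cases "(i, projl j) \<in> PA"; cases "i = projr j"; cases "projr j \<in> S")
      (auto simp: controlled_mat_nth intro!: continuous_intros)
next
  fix x c
  have "controlled_mat QA PA S (\<theta> + c *\<^sub>R (x - \<theta>)) $ i $ j =
    (controlled_mat QA PA S \<theta> + c *\<^sub>R (controlled_mat QA PA S x - controlled_mat QA PA S \<theta>)) $ i $ j" for i j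
    by (cases j) (auto simp: controlled_mat_nth algebra_simps)
  then show "controlled_mat QA PA S (\<theta> + c *\<^sub>R (x - \<theta>)) =
    controlled_mat QA PA S \<theta> + c *\<^sub>R (controlled_mat QA PA S x - controlled_mat QA PA S \<theta>)"
    by (simp add: vec_eq_iff)
qed

lemma AE_component_nonzero:
  "AE \<theta> in (lborel :: 'n params measure). snd (snd \<theta>) $ i \<noteq> 0" for i :: "'n::finite"
proof (rule AE_nonzero_if_polynomial_on_lines[where a = "(0, 0, axis i 1) :: 'n params"])
  show "continuous_on UNIV (\<lambda>\<theta> :: 'n params. snd (snd \<theta>) $ i)" by (intro continuous_intros)
  show "snd (snd ((0, 0, axis i 1) :: 'n params)) $ i \<noteq> 0" by simp
  fix \<theta> :: "'n params"
  show "\<exists>p. \<forall>c. snd (snd ((0, 0, axis i 1) + c *\<^sub>R (\<theta> - (0, 0, axis i 1)))) $ i = poly p c"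
    by (intro exI[of _ "[: 1, snd (snd \<theta>) $ i - 1 :]"]) simp
qed

lemma span_columns_input_mat:
  fixes A :: "real^'n^'n"
  assumes "\<And>i. i \<in> S \<Longrightarrow> b $ i \<noteq> 0"
  shows "span (columns (hcat A (input_mat S b))) = span (columns A \<union> (\<lambda>i. axis i 1) ` S)"
proof -
  have col: "column i (input_mat S b) = (if i \<in> S then b $ i *\<^sub>R axis i 1 else 0)" for i
    by (auto simp: column_def input_mat_def axis_def vec_eq_iff)
  have cols: "columns (hcat A (input_mat S b)) = columns A \<union> range (\<lambda>i. column i (input_mat S b))"
  proof -
    have "columns M = range (\<lambda>j. column j M)" for M :: "real^'c^'d" by (auto simp: columns_def)
    moreover have "range f = range (\<lambda>i. f (Inl i)) \<union> range (\<lambda>i. f (Inr i))" for f :: "'n + 'n \<Rightarrow> real^'n"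
      unfolding UNIV_sum by auto
    ultimately show ?thesis by (metis (no_types, lifting) column_hcat image_cong)
  qed
  show ?thesis
  proof (rule antisym)
    show "span (columns (hcat A (input_mat S b))) \<subseteq> span (columns A \<union> (\<lambda>i. axis i 1) ` S)"
      by (rule span_minimal) (auto simp: cols col intro: span_base span_scale span_zero)
    have "axis i 1 \<in> span (columns (hcat A (input_mat S b)))" if "i \<in> S" for i
    proof -
      have "(1 / b $ i) *\<^sub>R column i (input_mat S b) \<in> span (columns (hcat A (input_mat S b)))"
        by (intro span_scale span_base) (simp add: cols)
      then show ?thesis using that assms by (simp add: col)
    qed
    then show "span (columns A \<union> (\<lambda>i. axis i 1) ` S) \<subseteq> span (columns (hcat A (input_mat S b)))"
      by (intro span_minimal) (auto simp: cols intro: span_base)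
  qed
qed

lemma rank_eq_dim_span: "rank M = dim (span (columns M))" for M :: "real^'c^'r"
  by (simp add: column_rank_def)

lemma span_range_axis: "span (V \<union> range (\<lambda>i. axis i (1::real))) = UNIV"
proof -
  have "x \<in> span (V \<union> range (\<lambda>i. axis i 1))" for x
    by (subst sum_axis[of x, symmetric]) (intro span_sum span_scale span_base, auto)
  then show ?thesis by auto
qed

text \<open>
  The hypothesis \<open>generic\<close> says that every input set which yields full rank at some parameter value does so
  at \<open>\<theta>\<^sub>0\<close>. This already makes all ranks maximal at \<open>\<theta>\<^sub>0\<close>: if the rank is \<open>k\<close> at \<open>\<theta>\<close>, then \<open>n - k\<close> further
  inputs yield full rank, and removing them again lowers the rank at \<open>\<theta>\<^sub>0\<close> by at most \<open>n - k\<close>.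
\<close>

lemma rank_controlled_mat_le_generic:
  fixes QA :: "real^'n^'n"
  assumes generic: "\<And>S \<theta>. rank (controlled_mat QA PA S \<theta>) = CARD('n) \<Longrightarrow>
      rank (controlled_mat QA PA S \<theta>\<^sub>0) = CARD('n)"
    and nz: "\<And>i. snd (snd \<theta>\<^sub>0) $ i \<noteq> 0"
  shows "rank (controlled_mat QA PA S \<theta>) \<le> dim (columns (A_at QA PA \<theta>\<^sub>0) \<union> (\<lambda>i. axis i 1) ` S)"
proof -
  let ?e = "\<lambda>i. axis i (1::real)"
  let ?V = "columns (controlled_mat QA PA S \<theta>)"
  let ?W = "columns (A_at QA PA \<theta>\<^sub>0)"
  have full: "span (?V \<union> range ?e) = UNIV" by (rule span_range_axis)
  obtain X where X: "dim (?V \<union> ?e ` X) = dim ?V + card X" "dim (?V \<union> ?e ` X) = dim (?V \<union> range ?e)"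
    using independent_modulo_basis[of UNIV ?V ?e] by auto
  \<comment> \<open>all input parameters are set to one, so that the inputs in \<open>S \<union> X\<close> are effective\<close>
  define \<theta>' where "\<theta>' = (fst \<theta>, fst (snd \<theta>), (\<chi> i. 1) :: real^'n)"
  have A: "A_at QA PA \<theta>' = A_at QA PA \<theta>" by (simp add: A_at_def \<theta>'_def)
  have span': "span (columns (controlled_mat QA PA (S \<union> X) \<theta>')) =
      span (columns (A_at QA PA \<theta>) \<union> ?e ` (S \<union> X))"
    unfolding controlled_mat_def B_at_def
    by (subst span_columns_input_mat) (simp_all add: A, simp add: \<theta>'_def)
  have "column j (controlled_mat QA PA S \<theta>) \<in> span (columns (A_at QA PA \<theta>) \<union> ?e ` (S \<union> X))" for j
  proof (cases j)
    case (Inl k)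
    then show ?thesis unfolding controlled_mat_def
      by (auto simp: column_hcat columns_def intro!: span_base)
  next
    case (Inr k)
    have "column k (B_at S \<theta>) = (if k \<in> S then snd (snd \<theta>) $ k *\<^sub>R ?e k else 0)"
      by (auto simp: column_def B_at_def input_mat_def axis_def vec_eq_iff)
    then show ?thesis using Inr unfolding controlled_mat_def
      by (auto simp: column_hcat intro!: span_base span_scale span_zero)
  qed
  then have "?V \<union> ?e ` X \<subseteq> span (columns (controlled_mat QA PA (S \<union> X) \<theta>'))"
    unfolding span' by (auto simp: columns_def intro: span_base)
  then have "dim (?V \<union> ?e ` X) \<le> rank (controlled_mat QA PA (S \<union> X) \<theta>')"
    unfolding rank_eq_dim_span by (rule dim_subset)
  moreover have "dim (?V \<union> ?e ` X) = CARD('n)"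
    using full by (metis X(2) dim_UNIV dim_span DIM_cart DIM_real mult_1_right)
  ultimately have "rank (controlled_mat QA PA (S \<union> X) \<theta>') = CARD('n)"
    using rank_bound[of "controlled_mat QA PA (S \<union> X) \<theta>'"] by simp
  then have "rank (controlled_mat QA PA (S \<union> X) \<theta>\<^sub>0) = CARD('n)" by (rule generic)
  then have "CARD('n) = dim (?W \<union> ?e ` (S \<union> X))"
    unfolding rank_eq_dim_span controlled_mat_def B_at_def
    by (subst (asm) span_columns_input_mat) (simp_all add: nz)
  also have "\<dots> \<le> dim (?W \<union> ?e ` S) + card X" by (rule dim_union_le_card) simp
  finally show ?thesis
    using X(1) \<open>dim (?V \<union> ?e ` X) = CARD('n)\<close> by (simp add: column_rank_def)
qed

lemma rank_controlled_mat_generic: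
  fixes QA :: "real^'n^'n"
  assumes nz: "\<And>i. snd (snd \<theta>) $ i \<noteq> 0"
  shows "rank (controlled_mat QA PA S \<theta>) = dim (columns (A_at QA PA \<theta>) \<union> (\<lambda>i. axis i 1) ` S)"
  unfolding rank_eq_dim_span controlled_mat_def B_at_def
  by (subst span_columns_input_mat) (simp_all add: nz)

lemma rank_controlled_mat_empty: "rank (controlled_mat QA PA {} \<theta>) = rank (A_at QA PA \<theta>)"
  unfolding rank_eq_dim_span controlled_mat_def B_at_def
  by (subst span_columns_input_mat) simp_all

lemma rho1_eq_dim:
  fixes QA :: "real^'n^'n" and \<theta>\<^sub>0 :: "'n::finite params"
  assumes generic: "\<And>S \<theta>. rank (controlled_mat QA PA S \<theta>) = CARD('n) \<Longrightarrow>
      rank (controlled_mat QA PA S \<theta>\<^sub>0) = CARD('n)"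
    and nz: "\<And>i. snd (snd \<theta>\<^sub>0) $ i \<noteq> 0"
  defines "V \<equiv> columns (A_at QA PA \<theta>\<^sub>0)"
  shows "rho1 QA PA S = dim (V \<union> (\<lambda>i. axis i 1) ` S) - dim V"
proof -
  let ?e = "\<lambda>i. axis i (1::real)"
  note le = rank_controlled_mat_le_generic[of QA PA \<theta>\<^sub>0, OF generic nz, folded V_def]
  define P where "P = {(i, Inl j :: 'n + 'n) | i j. (i, j) \<in> PA} \<union> {(i, Inr i) | i. i \<in> S}"
  define \<iota> where "\<iota> = (\<lambda>(i, j). case j of Inl k \<Rightarrow> to_nat (Inl (i, k) :: ('n \<times> 'n) + 'n)
    | Inr k \<Rightarrow> to_nat (Inr k :: ('n \<times> 'n) + 'n))"
  have \<iota>: "inj_on \<iota> P" by (auto simp: inj_on_def P_def \<iota>_def)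
  have TAB: "hcat (generic_TA PA) (generic_TB S) = fill P (generic \<iota>)"
    by (auto simp: hcat_def generic_TA_def generic_TB_def struct_mat_def input_mat_def fill_def
        generic_def vec_eq_iff P_def \<iota>_def indet_def var_def split: sum.split)
  let ?r1 = "matroid_rank (matroid_union
       (linear_matroid (hcat (mat 1 :: real^'n^'n) (hcat QA (0 :: real^'n^'n))))
       (linear_matroid (hcat (mat 1 :: ratfun^'n^'n) (hcat (generic_TA PA) (generic_TB S)))))"
  have mat: "hcat QA 0 + fill P t = controlled_mat QA PA S
      (0, (\<chi> i j. t $ i $ Inl j), (\<chi> i. t $ i $ Inr i))" for t
  proof -
    have "(hcat QA 0 + fill P t) $ i $ j = controlled_mat QA PA S
      (0, (\<chi> i j. t $ i $ Inl j), (\<chi> i. t $ i $ Inr i)) $ i $ j" for i j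
      by (cases j) (auto simp: controlled_mat_nth, auto simp: hcat_def fill_def P_def)
    then show ?thesis by (simp add: vec_eq_iff)
  qed
  have "?r1 \<le> CARD('n) + dim (V \<union> ?e ` S)"
    using rank_matroid_union_attained[OF \<iota>, of "hcat QA 0"] le[where S = S]
    unfolding TAB mat by (meson add_left_mono order_trans)
  moreover have "CARD('n) + dim (V \<union> ?e ` S) \<le> ?r1"
  proof -
    define t where "t = (\<chi> i j. case j :: 'n + 'n of Inl k \<Rightarrow> fst (snd \<theta>\<^sub>0) $ i $ k | Inr k \<Rightarrow> snd (snd \<theta>\<^sub>0) $ i)"
    have "controlled_mat QA PA S (0, (\<chi> i j. t $ i $ Inl j), (\<chi> i. t $ i $ Inr i)) = controlled_mat QA PA S \<theta>\<^sub>0"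
      by (simp add: controlled_mat_def A_at_def B_at_def t_def)
    then show ?thesis
      using rank_le_rank_matroid_union[OF \<iota>, of "hcat QA 0" t]
        rank_controlled_mat_generic[of \<theta>\<^sub>0, OF nz]
      unfolding TAB mat V_def by simp
  qed
  ultimately have r1: "?r1 = CARD('n) + dim (V \<union> ?e ` S)" by simp
  let ?r2 = "matroid_rank (matroid_union
       (linear_matroid (hcat (mat 1 :: real^'n^'n) QA))
       (linear_matroid (hcat (mat 1 :: ratfun^'n^'n) (generic_TA PA))))"
  define \<kappa> where "\<kappa> = (\<lambda>p. to_nat (Inl p :: ('n \<times> 'n) + 'n))"
  have \<kappa>: "inj_on \<kappa> PA" by (auto simp: inj_on_def \<kappa>_def)
  have TA: "generic_TA PA = fill PA (generic \<kappa>)"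
    by (auto simp: generic_TA_def struct_mat_def fill_def generic_def vec_eq_iff \<kappa>_def indet_def var_def)
  have A: "QA + fill PA t = A_at QA PA (0, t, 0)" for t
    by (simp add: A_at_def struct_mat_def fill_def)
  have "?r2 \<le> CARD('n) + dim V"
    using rank_matroid_union_attained[OF \<kappa>, of QA] le[where S = "{}"]
    unfolding TA A rank_controlled_mat_empty image_empty Un_empty_right
    by (meson add_left_mono order_trans)
  moreover have "CARD('n) + dim V \<le> ?r2"
    using rank_le_rank_matroid_union[OF \<kappa>, of QA "fst (snd \<theta>\<^sub>0)"]
    unfolding TA V_def by (simp add: A_at_def struct_mat_def fill_def column_rank_def)
  ultimately have "?r2 = CARD('n) + dim V" by simp
  with r1 show ?thesis unfolding rho1_def by simp
qed

text \<open>
  The second part describes the dual of \<open>M\<^sub>1\<close> by a single set of real vectors: \<open>V\<close> is the set of columns of \<open>A\<close> at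
  a parameter value at which all ranks are maximal.
\<close>

lemma dual_matroid_M1_iff_full_rank:
  fixes QA :: "real^'n^'n"
  shows "R \<in> dual_matroid (matroid_M1 QA PA) \<longleftrightarrow> (\<exists>\<theta>. rank (controlled_mat QA PA (UNIV - R) \<theta>) = CARD('n))"
    (is ?th1)
    and "\<exists>V. \<forall>S. dim (V \<union> (\<lambda>i. axis i 1) ` S :: (real^'n) set) = CARD('n) \<longleftrightarrow>
      UNIV - S \<in> dual_matroid (matroid_M1 QA PA)" (is ?th2)
proof -
  have "AE \<theta>\<^sub>0 in lborel. \<forall>S. (\<exists>\<theta>. rank (controlled_mat QA PA S \<theta>) = CARD('n)) \<longrightarrow>
      rank (controlled_mat QA PA S \<theta>\<^sub>0) = CARD('n)"
  proof (rule eventually_all_finite)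
    fix S
    show "AE \<theta>\<^sub>0 in lborel. (\<exists>\<theta>. rank (controlled_mat QA PA S \<theta>) = CARD('n)) \<longrightarrow>
      rank (controlled_mat QA PA S \<theta>\<^sub>0) = CARD('n)"
    proof (cases "\<exists>\<theta>. rank (controlled_mat QA PA S \<theta>) = CARD('n)")
      case True
      then obtain \<theta> where "rank (controlled_mat QA PA S \<theta>) = CARD('n)" ..
      from AE_full_rank_controlled_mat[OF this] show ?thesis by eventually_elim simp
    qed simp
  qed
  moreover have "AE \<theta>\<^sub>0 in (lborel :: 'n params measure). \<forall>i. snd (snd \<theta>\<^sub>0) $ i \<noteq> 0"
    by (rule eventually_all_finite) (rule AE_component_nonzero)
  ultimately have AE: "AE \<theta>\<^sub>0 in lborel. (\<forall>S. (\<exists>\<theta>. rank (controlled_mat QA PA S \<theta>) = CARD('n)) \<longrightarrow>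
      rank (controlled_mat QA PA S \<theta>\<^sub>0) = CARD('n)) \<and> (\<forall>i. snd (snd \<theta>\<^sub>0) $ i \<noteq> 0)"
    by eventually_elim simp
  have "ae_filter (lborel :: 'n params measure) \<noteq> bot"
    by (simp add: ae_filter_eq_bot_iff)
  from eventually_happens'[OF this AE] obtain \<theta>\<^sub>0 where
    gen: "\<forall>S. (\<exists>\<theta>. rank (controlled_mat QA PA S \<theta>) = CARD('n)) \<longrightarrow>
      rank (controlled_mat QA PA S \<theta>\<^sub>0) = CARD('n)" and nz: "\<forall>i. snd (snd \<theta>\<^sub>0) $ i \<noteq> 0"
    by (elim exE conjE)
  have \<theta>\<^sub>0: "\<And>S \<theta>. rank (controlled_mat QA PA S \<theta>) = CARD('n) \<Longrightarrow>
      rank (controlled_mat QA PA S \<theta>\<^sub>0) = CARD('n)" "\<And>i. snd (snd \<theta>\<^sub>0) $ i \<noteq> 0"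
    using gen nz by (metis, metis)
  define V where "V = columns (A_at QA PA \<theta>\<^sub>0)"
  let ?e = "\<lambda>i. axis i (1::real)"
  have "dim V \<le> dim (V \<union> ?e ` X)" for X by (rule dim_subset) auto
  then have diff: "dim (V \<union> ?e ` X) - dim V = card X \<longleftrightarrow> dim (V \<union> ?e ` X) = dim V + card X" for X
    using le_add_diff_inverse diff_add_inverse by metis
  have rho: "rho1 QA PA S = dim (V \<union> ?e ` S) - dim V" for S
    unfolding V_def by (rule rho1_eq_dim) (fact \<theta>\<^sub>0)+
  have "matroid_M1 QA PA = {X. dim (V \<union> ?e ` X) = dim V + card X}"
    unfolding matroid_M1_def rho diff by (rule refl)
  from dual_matroid_contraction[OF this]
  have iff: "R \<in> dual_matroid (matroid_M1 QA PA) \<longleftrightarrow> dim (V \<union> ?e ` (UNIV - R)) = CARD('n)" for R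
    using span_range_axis[of "columns (A_at QA PA \<theta>\<^sub>0)"] by (simp add: V_def)
  have "(\<exists>\<theta>. rank (controlled_mat QA PA S \<theta>) = CARD('n)) \<longleftrightarrow> dim (V \<union> ?e ` S) = CARD('n)" for S
    unfolding V_def rank_controlled_mat_generic[OF \<theta>\<^sub>0(2), of QA PA S, symmetric]
    using \<theta>\<^sub>0(1)[of S] by blast
  then show ?th1 by (simp add: iff)
  show ?th2 by (intro exI[of _ V]) (simp add: iff double_diff)
qed

section \<open>Linear relations and orthogonality\<close>

lemma linear_relation:
  fixes f :: "nat \<Rightarrow> 'a::field^'n"
  obtains c where "(\<Sum>k\<le>CARD('n). c k *s f k) = 0" "\<exists>k\<le>CARD('n). c k \<noteq> 0"
proof (cases "inj_on f {..CARD('n)}")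
  case True
  then have "card (f ` {..CARD('n)}) = Suc (CARD('n))" by (simp add: card_image)
  moreover have "vec.dim (f ` {..CARD('n)}) \<le> CARD('n)" by (rule dim_subset_UNIV_cart_gen)
  ultimately have "vec.dependent (f ` {..CARD('n)})"
    using vec.dim_eq_card_independent[of "f ` {..CARD('n)}"] by linarith
  then obtain u where u: "\<exists>v\<in>f ` {..CARD('n)}. u v \<noteq> 0" "(\<Sum>v\<in>f ` {..CARD('n)}. u v *s v) = 0"
    by (subst (asm) vec.dependent_finite) auto
  show thesis
  proof (rule that[of "\<lambda>k. u (f k)"])
    show "(\<Sum>k\<le>CARD('n). u (f k) *s f k) = 0"
      using u(2) by (subst (asm) sum.reindex[OF True]) simp
    show "\<exists>k\<le>CARD('n). u (f k) \<noteq> 0" using u(1) by auto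
  qed
next
  case False
  then obtain k l where kl: "k \<le> CARD('n)" "l \<le> CARD('n)" "k \<noteq> l" "f k = f l"
    by (auto simp: inj_on_def)
  let ?c = "\<lambda>i. if i = k then 1 else if i = l then - 1 else (0::'a)"
  have "(\<Sum>i\<le>CARD('n). ?c i *s f i) = (\<Sum>i\<in>{k, l}. ?c i *s f i)"
    by (rule sum.mono_neutral_right) (use kl in auto)
  also have "\<dots> = 0" using kl by simp
  finally have "(\<Sum>i\<le>CARD('n). ?c i *s f i) = 0" .
  moreover have "?c k \<noteq> 0" by simp
  ultimately show thesis using that[of ?c] kl(1) by blast
qed

lemma full_rank_left_kernel:
  fixes M :: "'a::field^'c^'r"
  assumes "rank M = CARD('r)" "w v* M = 0"
  shows "w = 0"
proof (rule ccontr)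
  assume "w \<noteq> 0"
  then obtain i where i: "w $ i \<noteq> 0" by (auto simp: vec_eq_iff)
  let ?W = "(\<lambda>j. row j M) ` (UNIV - {i})"
  have "(\<Sum>j\<in>UNIV. w $ j *s row j M) = 0"
    using assms(2) by (simp add: vec_eq_iff vector_matrix_mult_def row_def mult.commute)
  then have "w $ i *s row i M = - (\<Sum>j\<in>UNIV - {i}. w $ j *s row j M)"
    by (subst (asm) sum.remove[of _ i]) (auto simp: eq_neg_iff_add_eq_0)
  moreover have "\<dots> \<in> vec.span ?W"
    by (intro vec.span_neg vec.span_sum vec.span_scale vec.span_base) auto
  ultimately have "w $ i *s row i M \<in> vec.span ?W" by (simp only:)
  then have "inverse (w $ i) *s (w $ i *s row i M) \<in> vec.span ?W" by (rule vec.span_scale)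
  then have "row i M \<in> vec.span ?W" using i by (simp add: vector_smult_assoc)
  then have "row j M \<in> vec.span ?W" for j
    by (cases "j = i") (auto intro: vec.span_base)
  then have "rows M \<subseteq> vec.span ?W" by (auto simp: rows_def)
  then have "vec.dim (rows M) \<le> card ?W" by (rule vec.dim_le_card) simp
  also have "\<dots> \<le> card (UNIV - {i})" by (rule card_image_le) simp
  also have "\<dots> < CARD('r)" by (simp add: card_Diff_singleton)
  finally show False using assms(1) by (simp add: row_rank_def_gen)
qed

lemma span_iff_orthogonal:
  fixes S :: "'a::euclidean_space set"
  assumes "\<And>a. (\<And>y. y \<in> S \<Longrightarrow> a \<bullet> y = 0) \<Longrightarrow> a \<bullet> z = 0"
  shows "z \<in> span S"
proof -
  have "z \<in> (span S)\<^sup>\<bottom>\<^sup>\<bottom>"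
    unfolding orthogonal_comp_def[of "(span S)\<^sup>\<bottom>"]
  proof (safe)
    fix a assume "a \<in> (span S)\<^sup>\<bottom>"
    then have "a \<bullet> y = 0" if "y \<in> S" for y
      using span_base[OF that] by (auto simp: orthogonal_comp_def orthogonal_def inner_commute)
    from assms[OF this] show "orthogonal a z" by (simp add: orthogonal_def)
  qed
  then show ?thesis by (simp add: orthogonal_comp_self)
qed

section \<open>Nilpotent operators, polynomials and exponentials\<close>

text \<open>
  The value \<open>p(T) x\<close> of a polynomial \<open>p\<close> in the operator \<open>T\<close> at the vector \<open>x\<close>.
\<close>

definition poly_op :: "('a::field^'n \<Rightarrow> 'a^'n) \<Rightarrow> 'a poly \<Rightarrow> 'a^'n \<Rightarrow> 'a^'n" where
  "poly_op T p x = (\<Sum>i\<le>degree p. coeff p i *s (T ^^ i) x)"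

lemma poly_op_bound:
  assumes "degree p \<le> n"
  shows "poly_op T p x = (\<Sum>i\<le>n. coeff p i *s (T ^^ i) x)"
  unfolding poly_op_def
  by (rule sum.mono_neutral_left) (use assms in \<open>auto simp: coeff_eq_0\<close>)

lemma poly_op_mult_linear_factor:
  assumes "Vector_Spaces.linear (*s) (*s) T"
  shows "poly_op T ([:- \<mu>, 1:] * q) x = T (poly_op T q x) - \<mu> *s poly_op T q x"
    and "T (poly_op T q x) = poly_op T q (T x)"
proof -
  interpret T: Vector_Spaces.linear "(*s)" "(*s)" T by fact
  let ?n = "degree q"
  have T1: "T (poly_op T q x) = (\<Sum>i\<le>?n. coeff q i *s (T ^^ Suc i) x)"
    by (simp add: poly_op_def T.sum T.scale)
  then show "T (poly_op T q x) = poly_op T q (T x)"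
    by (simp add: poly_op_def funpow_swap1)
  have "degree ([:- \<mu>, 1:] * q) \<le> Suc ?n"
    by (rule order_trans[OF degree_mult_le]) simp
  then have "poly_op T ([:- \<mu>, 1:] * q) x = (\<Sum>i\<le>Suc ?n. coeff ([:- \<mu>, 1:] * q) i *s (T ^^ i) x)"
    by (rule poly_op_bound)
  also have "\<dots> = (\<Sum>i\<le>Suc ?n. coeff (pCons 0 q) i *s (T ^^ i) x) - (\<Sum>i\<le>Suc ?n. \<mu> *s (coeff q i *s (T ^^ i) x))"
    unfolding sum_subtractf[symmetric]
    by (rule sum.cong) (simp_all add: vector_smult_assoc algebra_simps vec_eq_iff)
  also have "(\<Sum>i\<le>Suc ?n. coeff (pCons 0 q) i *s (T ^^ i) x) = T (poly_op T q x)"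
    unfolding T1 by (subst sum.atMost_Suc_shift) simp
  also have "(\<Sum>i\<le>Suc ?n. \<mu> *s (coeff q i *s (T ^^ i) x)) = \<mu> *s poly_op T q x"
    by (simp add: poly_op_def vec.scale_sum_right coeff_eq_0)
  finally show "poly_op T ([:- \<mu>, 1:] * q) x = T (poly_op T q x) - \<mu> *s poly_op T q x" .
qed

text \<open>
  A polynomial that annihilates \<open>x\<close> is split into linear factors; factors with nonzero roots can be
  cancelled, since they are injective on \<open>N\<close>.
\<close>

lemma nilpotent_if_no_eigenvector:
  fixes T :: "complex^'n \<Rightarrow> complex^'n"
  assumes T: "Vector_Spaces.linear (*s) (*s) T" and N: "vec.subspace N" "\<And>x. x \<in> N \<Longrightarrow> T x \<in> N"
    and no_eigen: "\<And>\<mu> e. e \<in> N \<Longrightarrow> T e = \<mu> *s e \<Longrightarrow> \<mu> \<noteq> 0 \<Longrightarrow> e = 0"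
    and x: "x \<in> N"
  shows "\<exists>k. (T ^^ k) x = 0"
proof -
  have pow: "(T ^^ i) y \<in> N" if "y \<in> N" for i y
    using that by (induction i) (auto intro: N)
  have poly_N: "poly_op T p y \<in> N" if "y \<in> N" for p y
    unfolding poly_op_def using that by (intro vec.subspace_sum vec.subspace_scale N pow)
  have main: "\<exists>k. (T ^^ k) y = 0" if "degree p = d" "p \<noteq> 0" "y \<in> N" "poly_op T p y = 0" for p y d
    using that
  proof (induction d arbitrary: p y)
    case 0
    then have "coeff p 0 \<noteq> 0" using leading_coeff_neq_0[of p] by simp
    then have "y = 0" using 0 by (simp add: poly_op_def vector_mul_eq_0)
    then show ?case by (intro exI[of _ 0]) simp
  next
    case (Suc d)
    then have "\<not> constant (poly p)" by (simp add: constant_degree)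
    then obtain \<mu> where "poly p \<mu> = 0" using fundamental_theorem_of_algebra by blast
    then obtain q where q: "p = [:- \<mu>, 1:] * q" using poly_eq_0_iff_dvd by blast
    have "q \<noteq> 0" using q Suc.prems(2) by auto
    then have "degree p = degree [:- \<mu>, 1:] + degree q"
      unfolding q by (intro degree_mult_eq) simp_all
    then have deg: "degree q = d" using Suc.prems(1) by simp
    have eq: "T (poly_op T q y) - \<mu> *s poly_op T q y = 0"
      using Suc.prems(4) unfolding q poly_op_mult_linear_factor(1)[OF T] .
    show ?case
    proof (cases "\<mu> = 0")
      case False
      then have "poly_op T q y = 0"
        using no_eigen[OF poly_N[OF Suc.prems(3)], of q \<mu>] eq by simp
      then show ?thesis by (rule Suc.IH[OF deg \<open>q \<noteq> 0\<close> Suc.prems(3)])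
    next
      case True
      then have "poly_op T q (T y) = 0"
        using eq poly_op_mult_linear_factor(2)[OF T, of q y] by simp
      then obtain k where "(T ^^ k) (T y) = 0"
        using Suc.IH[OF deg \<open>q \<noteq> 0\<close> N(2)[OF Suc.prems(3)]] by blast
      then show ?thesis by (intro exI[of _ "Suc k"]) (simp add: funpow_swap1)
    qed
  qed
  obtain c where c: "(\<Sum>k\<le>CARD('n). c k *s (T ^^ k) x) = 0" "\<exists>k\<le>CARD('n). c k \<noteq> 0"
    using linear_relation[of "\<lambda>k. (T ^^ k) x"] by blast
  define p where "p = (\<Sum>k\<le>CARD('n). monom (c k) k)"
  have coeff: "coeff p k = (if k \<le> CARD('n) then c k else 0)" for k
    by (simp add: p_def coeff_sum)
  have "p \<noteq> 0" using c(2) coeff by (metis coeff_0)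
  have "degree p \<le> CARD('n)" by (rule degree_le) (simp add: coeff)
  then have "poly_op T p x = 0" using c(1) by (simp add: poly_op_bound coeff)
  from main[OF refl \<open>p \<noteq> 0\<close> x this] show ?thesis .
qed

text \<open>
  The polynomial \<open>q\<close> tends to \<open>0\<close> because it agrees with \<open>- p / exp\<close>.
\<close>

lemma poly_exp_independent:
  fixes p q :: "real poly"
  assumes "eventually (\<lambda>x. poly p x + exp x * poly q x = 0) at_top"
  shows "p = 0" "q = 0"
proof -
  have ev0: "r = 0" if "eventually (\<lambda>x. poly r x = 0) at_top" for r :: "real poly"
  proof (rule ccontr)
    assume "r \<noteq> 0"
    then have "finite {x. poly r x = 0}" by (rule poly_roots_finite)
    moreover obtain N where "\<And>x. x \<ge> N \<Longrightarrow> poly r x = 0"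
      using \<open>eventually (\<lambda>x. poly r x = 0) at_top\<close> by (auto simp: eventually_at_top_linorder)
    then have "{N..} \<subseteq> {x. poly r x = 0}" by auto
    ultimately show False using infinite_Ici[of N] finite_subset by blast
  qed
  have "((\<lambda>x. \<Sum>i\<le>degree p. coeff p i * (x ^ i / exp x)) \<longlongrightarrow> (\<Sum>i\<le>degree p. coeff p i * 0)) at_top"
    by (intro tendsto_sum tendsto_mult tendsto_const tendsto_power_div_exp_0)
  then have "((\<lambda>x. poly p x / exp x) \<longlongrightarrow> 0) at_top"
    by (simp add: poly_altdef sum_divide_distrib)
  from tendsto_minus[OF this] have "((\<lambda>x. - (poly p x / exp x)) \<longlongrightarrow> 0) at_top" by simp
  moreover have "eventually (\<lambda>x. - (poly p x / exp x) = poly q x) at_top"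
    using assms by eventually_elim (simp add: field_simps eq_neg_iff_add_eq_0 add.commute)
  ultimately have lim: "(poly q \<longlongrightarrow> 0) at_top" by (rule Lim_transform_eventually)
  have "degree q = 0"
  proof (rule ccontr)
    assume "degree q \<noteq> 0"
    then have "filterlim (poly q) at_infinity at_infinity" by (simp add: filterlim_poly_at_infinity)
    then have "filterlim (poly q) at_infinity at_top"
      by (rule filterlim_mono) (simp_all add: at_top_le_at_infinity)
    with lim show False using not_tendsto_and_filterlim_at_infinity[of at_top "poly q"] by simp
  qed
  then obtain a where "q = [:a:]" by (rule degree_eq_zeroE)
  then have "poly q = (\<lambda>x. a)" by (simp add: fun_eq_iff)
  with lim have "((\<lambda>x::real. a) \<longlongrightarrow> 0) at_top" by simp
  then have "a = 0" by (simp add: tendsto_const_iff)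
  with \<open>q = [:a:]\<close> show "q = 0" by simp
  with assms ev0[of p] show "p = 0" by simp
qed

text \<open>
  By Cramer's rule, the solutions of \<open>(\<sigma> F - A) w = b\<close> are rational functions of \<open>\<sigma>\<close> with common denominator \<open>D\<close>.
\<close>

lemma pencil_cramer:
  fixes F A :: "real^'n^'n"
  assumes s0: "det (s0 *\<^sub>R F - A) \<noteq> 0"
  obtains D where "D \<noteq> 0" "\<And>\<sigma>. poly D \<sigma> = det (\<sigma> *\<^sub>R F - A)"
    "\<And>b a. \<exists>p. \<forall>\<sigma> w. det (\<sigma> *\<^sub>R F - A) \<noteq> 0 \<longrightarrow> (\<sigma> *\<^sub>R F - A) *v w = b \<longrightarrow> a \<bullet> w = poly p \<sigma> / poly D \<sigma>"
proof -
  define C where "C = (\<chi> i j. [:- A $ i $ j, F $ i $ j:])"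
  have C: "(\<chi> i j. poly (C $ i $ j) \<sigma>) = \<sigma> *\<^sub>R F - A" for \<sigma>
    by (simp add: C_def vec_eq_iff)
  have D: "poly (det C) \<sigma> = det (\<sigma> *\<^sub>R F - A)" for \<sigma>
    using det_ring_hom[of "\<lambda>p. poly p \<sigma>" C] by (simp add: C)
  have "det C \<noteq> 0" using D[of s0] s0 by auto
  moreover have "\<exists>p. \<forall>\<sigma> w. det (\<sigma> *\<^sub>R F - A) \<noteq> 0 \<longrightarrow> (\<sigma> *\<^sub>R F - A) *v w = b \<longrightarrow>
      a \<bullet> w = poly p \<sigma> / poly (det C) \<sigma>" for a b
  proof -
    define Ck where "Ck k = (\<chi> i j. if j = k then [:b $ i:] else C $ i $ j)" for k
    have Ck: "poly (det (Ck k)) \<sigma> = det (\<chi> i j. if j = k then b $ i else (\<sigma> *\<^sub>R F - A) $ i $ j)" for \<sigma> k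
    proof -
      have "(\<chi> i j. poly (Ck k $ i $ j) \<sigma>) = (\<chi> i j. if j = k then b $ i else (\<sigma> *\<^sub>R F - A) $ i $ j)"
        by (simp add: Ck_def C_def vec_eq_iff)
      then show ?thesis using det_ring_hom[of "\<lambda>p. poly p \<sigma>" "Ck k"] by simp
    qed
    have "a \<bullet> w = poly (\<Sum>k\<in>UNIV. smult (a $ k) (det (Ck k))) \<sigma> / poly (det C) \<sigma>"
      if "det (\<sigma> *\<^sub>R F - A) \<noteq> 0" "(\<sigma> *\<^sub>R F - A) *v w = b" for \<sigma> w
    proof -
      have "w $ k = poly (det (Ck k)) \<sigma> / poly (det C) \<sigma>" for k
        using that by (simp add: cramer Ck D)
      then show ?thesis by (simp add: inner_vec_def poly_sum sum_divide_distrib)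
    qed
    then show ?thesis by blast
  qed
  ultimately show thesis using that[of "det C"] D by blast
qed

section \<open>Trajectories of descriptor systems\<close>

lemma trajectory_exp:
  assumes "(\<sigma> *\<^sub>R F - A) *v w = g"
  shows "is_trajectory F A (\<lambda>t. exp (\<sigma> * t) *\<^sub>R g) (\<lambda>t. exp (\<sigma> * t) *\<^sub>R w)"
  unfolding is_trajectory_def
proof (intro allI impI exI conjI)
  fix t :: real
  show "((\<lambda>t. exp (\<sigma> * t) *\<^sub>R w) has_vector_derivative (exp (\<sigma> * t) * \<sigma>) *\<^sub>R w) (at t within {0..})"
    by (auto intro!: derivative_eq_intros simp: has_vector_derivative_def)
  have "\<sigma> *\<^sub>R (F *v w) = A *v w + g"
    using assms by (simp add: matrix_vector_mult_diff_rdistrib scaleR_matrix_vector_assoc algebra_simps)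
  then have "exp (\<sigma> * t) *\<^sub>R (\<sigma> *\<^sub>R (F *v w)) = exp (\<sigma> * t) *\<^sub>R (A *v w + g)" by simp
  then show "F *v ((exp (\<sigma> * t) * \<sigma>) *\<^sub>R w) = A *v (exp (\<sigma> * t) *\<^sub>R w) + exp (\<sigma> * t) *\<^sub>R g"
    by (simp add: matrix_vector_mult_scaleR scaleR_add_right)
qed

lemma trajectory_add:
  assumes "is_trajectory F A f x" "is_trajectory F A g y"
  shows "is_trajectory F A (\<lambda>t. f t + g t) (\<lambda>t. x t + y t)"
  unfolding is_trajectory_def
proof (intro allI impI)
  fix t :: real assume "0 \<le> t"
  then obtain v w where "(x has_vector_derivative v) (at t within {0..})" "F *v v = A *v x t + f t"
    "(y has_vector_derivative w) (at t within {0..})" "F *v w = A *v y t + g t"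
    using assms unfolding is_trajectory_def by blast
  then show "\<exists>v. ((\<lambda>t. x t + y t) has_vector_derivative v) (at t within {0..}) \<and>
      F *v v = A *v (x t + y t) + (f t + g t)"
    by (intro exI[of _ "v + w"]) (auto intro: has_vector_derivative_add simp: matrix_vector_right_distrib)
qed

lemma trajectory_scale:
  assumes "is_trajectory F A f x"
  shows "is_trajectory F A (\<lambda>t. c *\<^sub>R f t) (\<lambda>t. c *\<^sub>R x t)"
  unfolding is_trajectory_def
proof (intro allI impI)
  fix t :: real assume "0 \<le> t"
  then obtain v where v: "(x has_vector_derivative v) (at t within {0..})" "F *v v = A *v x t + f t"
    using assms unfolding is_trajectory_def by blast
  have "((\<lambda>t. c *\<^sub>R x t) has_vector_derivative c *\<^sub>R v) (at t within {0..})"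
    using has_vector_derivative_scaleR[OF DERIV_const v(1), of c] by simp
  then show "\<exists>v. ((\<lambda>t. c *\<^sub>R x t) has_vector_derivative v) (at t within {0..}) \<and>
      F *v v = A *v (c *\<^sub>R x t) + c *\<^sub>R f t"
    by (intro exI[of _ "c *\<^sub>R v"]) (simp add: v(2) matrix_vector_mult_scaleR scaleR_add_right)
qed

lemma trajectory_zero: "is_trajectory F A (\<lambda>t. 0) (\<lambda>t. 0)"
  unfolding is_trajectory_def by (intro allI impI exI[of _ 0]) simp

lemma trajectory_sum:
  assumes "\<And>i. i \<in> I \<Longrightarrow> is_trajectory F A (\<lambda>t. 0) (x i)"
  shows "is_trajectory F A (\<lambda>t. 0) (\<lambda>t. \<Sum>i\<in>I. c i *\<^sub>R x i t)"
  using assms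
proof (induction I rule: infinite_finite_induct)
  case (insert i I)
  then have "is_trajectory F A (\<lambda>t. c i *\<^sub>R 0 + 0) (\<lambda>t. c i *\<^sub>R x i t + (\<Sum>i\<in>I. c i *\<^sub>R x i t))"
    by (intro trajectory_add trajectory_scale) auto
  then show ?case using insert.hyps by simp
qed (simp_all add: trajectory_zero)

lemma solvable_imp_regular:
  fixes F A :: "real^'n^'n"
  assumes "solvable F A"
  shows "\<exists>s. det (s *\<^sub>R F - A) \<noteq> 0"
proof (rule ccontr)
  assume "\<not> ?thesis"
  then have "\<exists>v. v \<noteq> 0 \<and> (s *\<^sub>R F - A) *v v = 0" for s
    using matrix_nonfull_linear_equations_eq[of "s *\<^sub>R F - A"] det_eq_0_rank[of "s *\<^sub>R F - A"] by auto
  then obtain v where v: "\<And>s. v s \<noteq> 0" "\<And>s. (s *\<^sub>R F - A) *v v s = 0" by metis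
  obtain c where c: "(\<Sum>k\<le>CARD('n). c k *s v (real k)) = 0" "\<exists>k\<le>CARD('n). c k \<noteq> 0"
    using linear_relation[of "\<lambda>k. v (real k)"] by blast
  define x where "x = (\<lambda>t. \<Sum>k\<le>CARD('n). c k *\<^sub>R (exp (real k * t) *\<^sub>R v (real k)))"
  have traj: "is_trajectory F A (\<lambda>t. 0) x"
    unfolding x_def using trajectory_exp[OF v(2)] by (intro trajectory_sum) simp
  have "x 0 = 0" using c(1) by (simp add: x_def scalar_mult_eq_scaleR)
  then have "0 \<in> autonomous_initial_states F A"
    using traj unfolding autonomous_initial_states_def by (intro CollectI exI[of _ x]) simp
  then obtain z where z: "\<And>y. y 0 = 0 \<and> is_trajectory F A (\<lambda>t. 0) y \<Longrightarrow> \<forall>t\<ge>0. y t = z t"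
    using assms unfolding solvable_def by meson
  have zero: "x t = 0" if "t \<ge> 0" for t
    using z[of x] z[of "\<lambda>t. 0"] \<open>x 0 = 0\<close> traj trajectory_zero[of F A] that by simp
  obtain k where k: "k \<le> CARD('n)" "c k \<noteq> 0" using c(2) by blast
  obtain i where i: "v (real k) $ i \<noteq> 0" using v(1) by (metis vec_eq_iff zero_index)
  have "(\<Sum>k\<le>CARD('n). (c k * v (real k) $ i) * y ^ k) = 0" if "y \<ge> 1" for y
  proof -
    have "x (ln y) $ i = (\<Sum>k\<le>CARD('n). (c k * v (real k) $ i) * exp (ln y) ^ k)"
      by (simp add: x_def exp_of_nat_mult mult_ac)
    then show ?thesis using zero[of "ln y"] that by simp
  qed
  \<comment> \<open>the substitution \<open>y = exp t\<close> turns the combination of exponentials into a polynomial with infinitely many roots\<close>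
  then have "{1..} \<subseteq> {y. (\<Sum>k\<le>CARD('n). (c k * v (real k) $ i) * y ^ k) = 0}" by auto
  moreover have "finite {y. (\<Sum>k\<le>CARD('n). (c k * v (real k) $ i) * y ^ k) = 0}"
    using k i by (subst Transcendental.polyfun_finite_roots) auto
  ultimately show False using infinite_Ici[of "1::real"] finite_subset by blast
qed

lemma controlled_trajectory_exp:
  assumes "(\<sigma> *\<^sub>R F - A) *v w = B *v h"
  shows "is_controlled_trajectory F A B (\<lambda>t. exp (\<sigma> * t) *\<^sub>R h) (\<lambda>t. exp (\<sigma> * t) *\<^sub>R w)"
  unfolding is_controlled_trajectory_def
  using trajectory_exp[OF assms] by (auto intro!: continuous_intros simp: matrix_vector_mult_scaleR)

text \<open>
  The pairs of states at the times \<open>0\<close> and \<open>1\<close> that are joined by a controlled trajectory.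
\<close>

lemma subspace_controlled_endpoints:
  "subspace {p. \<exists>u x. is_controlled_trajectory F A B u x \<and> p = (x 0, x (1::real))}"
  unfolding subspace_def
proof (intro conjI ballI allI)
  show "0 \<in> {p. \<exists>u x. is_controlled_trajectory F A B u x \<and> p = (x 0, x 1)}"
    using trajectory_zero[of F A]
    by (auto simp: is_controlled_trajectory_def zero_prod_def intro!: exI[of _ "\<lambda>t. 0"])
next
  fix p q assume "p \<in> {p. \<exists>u x. is_controlled_trajectory F A B u x \<and> p = (x 0, x 1)}"
    "q \<in> {p. \<exists>u x. is_controlled_trajectory F A B u x \<and> p = (x 0, x 1)}"
  then obtain u x v y where *: "is_controlled_trajectory F A B u x" "p = (x 0, x 1)"
    "is_controlled_trajectory F A B v y" "q = (y 0, y 1)" by blast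
  have "is_controlled_trajectory F A B (\<lambda>t. u t + v t) (\<lambda>t. x t + y t)"
    using * trajectory_add[of F A "\<lambda>t. B *v u t" x "\<lambda>t. B *v v t" y]
    by (auto simp: is_controlled_trajectory_def matrix_vector_right_distrib intro: continuous_on_add)
  then show "p + q \<in> {p. \<exists>u x. is_controlled_trajectory F A B u x \<and> p = (x 0, x 1)}"
    using *(2,4) by fastforce
next
  fix c p assume "p \<in> {p. \<exists>u x. is_controlled_trajectory F A B u x \<and> p = (x 0, x 1)}"
  then obtain u x where *: "is_controlled_trajectory F A B u x" "p = (x 0, x 1)" by blast
  have "is_controlled_trajectory F A B (\<lambda>t. c *\<^sub>R u t) (\<lambda>t. c *\<^sub>R x t)"
    using * trajectory_scale[of F A "\<lambda>t. B *v u t" x c]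
    by (auto simp: is_controlled_trajectory_def matrix_vector_mult_scaleR intro: continuous_on_scaleR continuous_on_const)
  then show "c *\<^sub>R p \<in> {p. \<exists>u x. is_controlled_trajectory F A B u x \<and> p = (x 0, x 1)}"
    using *(2) by fastforce
qed

section \<open>Rank of the pencil implies controllability\<close>

text \<open>
  The functional \<open>a\<close> vanishes on the range of the transfer function \<open>(\<sigma> F - A)\<^sup>-\<^sup>1 B\<close>, for all real \<open>\<sigma>\<close> at
  which it is defined.
\<close>

definition annihilates_transfer ::
    "real^'n^'n \<Rightarrow> real^'n^'n \<Rightarrow> real^'m^'n \<Rightarrow> real^'n \<Rightarrow> bool" where
  "annihilates_transfer F A B a \<longleftrightarrow> (\<forall>\<sigma> w h. det (\<sigma> *\<^sub>R F - A) \<noteq> 0 \<longrightarrow> (\<sigma> *\<^sub>R F - A) *v w = B *v h \<longrightarrow> a \<bullet> w = 0)"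

text \<open>
  The hypothesis \<open>orth\<close> says that \<open>(a, b)\<close> is orthogonal to the values of the trajectory \<open>exp (\<sigma> t) w\<close> at the times
  \<open>0\<close> and \<open>1\<close>.
\<close>

lemma exp_endpoints_orthogonal:
  fixes F A :: "real^'n^'n" and B :: "real^'m^'n"
  assumes s0: "det (s0 *\<^sub>R F - A) \<noteq> 0"
    and orth: "\<And>\<sigma> w h. det (\<sigma> *\<^sub>R F - A) \<noteq> 0 \<Longrightarrow> (\<sigma> *\<^sub>R F - A) *v w = B *v h \<Longrightarrow>
      a \<bullet> w + exp \<sigma> * (b \<bullet> w) = 0"
  shows "annihilates_transfer F A B a" "annihilates_transfer F A B b"
proof -
  obtain D where D: "D \<noteq> 0" "\<And>\<sigma>. poly D \<sigma> = det (\<sigma> *\<^sub>R F - A)"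
    and cr: "\<And>b a. \<exists>p. \<forall>\<sigma> w. det (\<sigma> *\<^sub>R F - A) \<noteq> 0 \<longrightarrow> (\<sigma> *\<^sub>R F - A) *v w = b \<longrightarrow> a \<bullet> w = poly p \<sigma> / poly D \<sigma>"
    using pencil_cramer[OF s0] by blast
  have main: "a \<bullet> w = 0 \<and> b \<bullet> w = 0"
    if w: "det (\<sigma> *\<^sub>R F - A) \<noteq> 0" "(\<sigma> *\<^sub>R F - A) *v w = B *v h" for \<sigma> w h
  proof -
    obtain p where p: "\<And>\<sigma> w. det (\<sigma> *\<^sub>R F - A) \<noteq> 0 \<Longrightarrow> (\<sigma> *\<^sub>R F - A) *v w = B *v h \<Longrightarrow> a \<bullet> w = poly p \<sigma> / poly D \<sigma>"
      using cr[of "B *v h" a] by blast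
    obtain q where q: "\<And>\<sigma> w. det (\<sigma> *\<^sub>R F - A) \<noteq> 0 \<Longrightarrow> (\<sigma> *\<^sub>R F - A) *v w = B *v h \<Longrightarrow> b \<bullet> w = poly q \<sigma> / poly D \<sigma>"
      using cr[of "B *v h" b] by blast
    have eq: "poly p \<tau> + exp \<tau> * poly q \<tau> = 0" if \<tau>: "poly D \<tau> \<noteq> 0" for \<tau>
    proof -
      have d: "det (\<tau> *\<^sub>R F - A) \<noteq> 0" using \<tau> D(2) by simp
      then have "surj ((*v) (\<tau> *\<^sub>R F - A))"
        using invertible_det_nz[of "\<tau> *\<^sub>R F - A"] matrix_right_invertible_surjective[of "\<tau> *\<^sub>R F - A"]
        by (auto simp: invertible_def)
      then obtain y where y: "(\<tau> *\<^sub>R F - A) *v y = B *v h" by (metis surjD)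
      from orth[OF d y] p[OF d y] q[OF d y] \<tau> show ?thesis by (simp add: field_simps)
    qed
    have "finite {\<tau>. poly D \<tau> = 0}" using D(1) by (rule poly_roots_finite)
    then obtain M where "\<And>\<tau>. poly D \<tau> = 0 \<Longrightarrow> \<tau> \<le> M"
      using bdd_above_finite[of "{\<tau>. poly D \<tau> = 0}"] by (auto simp: bdd_above_def)
    then have "eventually (\<lambda>\<tau>. poly p \<tau> + exp \<tau> * poly q \<tau> = 0) at_top"
      using eq by (intro eventually_mono[OF eventually_gt_at_top[of M]]) fastforce
    from poly_exp_independent[OF this] show ?thesis using p[OF w] q[OF w] by simp
  qed
  show "annihilates_transfer F A B a" "annihilates_transfer F A B b"
    unfolding annihilates_transfer_def using main by blast+
qed

lemma annihilates_transfer_cofinite: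
  fixes F A :: "real^'n^'n" and B :: "real^'m^'n"
  assumes s0: "det (s0 *\<^sub>R F - A) \<noteq> 0"
    and orth: "\<And>\<sigma> w h. \<sigma> \<noteq> s0 \<Longrightarrow> det (\<sigma> *\<^sub>R F - A) \<noteq> 0 \<Longrightarrow> (\<sigma> *\<^sub>R F - A) *v w = B *v h \<Longrightarrow> a \<bullet> w = 0"
  shows "annihilates_transfer F A B a"
  unfolding annihilates_transfer_def
proof (intro allI impI)
  obtain D where D: "D \<noteq> 0" "\<And>\<sigma>. poly D \<sigma> = det (\<sigma> *\<^sub>R F - A)"
    and cr: "\<And>b a. \<exists>p. \<forall>\<sigma> w. det (\<sigma> *\<^sub>R F - A) \<noteq> 0 \<longrightarrow> (\<sigma> *\<^sub>R F - A) *v w = b \<longrightarrow> a \<bullet> w = poly p \<sigma> / poly D \<sigma>"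
    using pencil_cramer[OF s0] by blast
  fix \<sigma> w h assume w: "det (\<sigma> *\<^sub>R F - A) \<noteq> 0" "(\<sigma> *\<^sub>R F - A) *v w = B *v h"
  obtain p where p: "\<And>\<sigma> w. det (\<sigma> *\<^sub>R F - A) \<noteq> 0 \<Longrightarrow> (\<sigma> *\<^sub>R F - A) *v w = B *v h \<Longrightarrow> a \<bullet> w = poly p \<sigma> / poly D \<sigma>"
    using cr[of "B *v h" a] by blast
  have "poly p \<tau> = 0" if \<tau>: "\<tau> \<noteq> s0" "poly D \<tau> \<noteq> 0" for \<tau>
  proof -
    have d: "det (\<tau> *\<^sub>R F - A) \<noteq> 0" using \<tau> D(2) by simp
    then have "surj ((*v) (\<tau> *\<^sub>R F - A))"
      using invertible_det_nz[of "\<tau> *\<^sub>R F - A"] matrix_right_invertible_surjective[of "\<tau> *\<^sub>R F - A"]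
      by (auto simp: invertible_def)
    then obtain y where y: "(\<tau> *\<^sub>R F - A) *v y = B *v h" by (metis surjD)
    from orth[OF \<tau>(1) d y] p[OF d y] \<tau> show ?thesis by simp
  qed
  then have "UNIV \<subseteq> {\<tau>. poly p \<tau> = 0} \<union> {\<tau>. poly D \<tau> = 0} \<union> {s0}" by blast
  moreover have "finite ({\<tau>. poly D \<tau> = 0} \<union> {s0})" using D(1) by (simp add: poly_roots_finite)
  ultimately have "infinite {\<tau>. poly p \<tau> = 0}"
    using infinite_UNIV_char_0[where 'a = real] by (metis finite_Un finite_subset Un_assoc)
  then have "p = 0" using poly_roots_finite by blast
  then show "a \<bullet> w = 0" using p[OF w] by simp
qed

text \<open>
  This is the resolvent identity \<open>G F w = (G B h - w) / (\<sigma> - s0)\<close> for \<open>(\<sigma> F - A) w = B h\<close>. It excludes the value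
  \<open>\<sigma> = s0\<close>, which follows by rationality (\<open>annihilates_transfer_cofinite\<close>).
\<close>

lemma annihilates_transfer_shift:
  fixes F A :: "real^'n^'n" and B :: "real^'m^'n"
  assumes G: "G ** (s0 *\<^sub>R F - A) = mat 1" and a: "annihilates_transfer F A B a"
  shows "annihilates_transfer F A B (a v* (G ** F))"
proof -
  have "(s0 *\<^sub>R F - A) ** G = mat 1" using G by (simp add: matrix_left_right_inverse)
  then have s0: "det (s0 *\<^sub>R F - A) \<noteq> 0"
    using G by (auto simp: invertible_det_nz[symmetric] invertible_def)
  show ?thesis
  proof (rule annihilates_transfer_cofinite[OF s0])
    fix \<sigma> w h assume \<sigma>: "\<sigma> \<noteq> s0" and w: "det (\<sigma> *\<^sub>R F - A) \<noteq> 0" "(\<sigma> *\<^sub>R F - A) *v w = B *v h"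
    let ?y = "G *v (B *v h)"
    have y: "(s0 *\<^sub>R F - A) *v ?y = B *v h"
      by (simp add: matrix_vector_mul_assoc matrix_mul_assoc \<open>(s0 *\<^sub>R F - A) ** G = mat 1\<close>)
    have "B *v h = (s0 *\<^sub>R F - A) *v w + (\<sigma> - s0) *\<^sub>R (F *v w)"
      unfolding w(2)[symmetric]
      by (simp add: matrix_vector_mult_diff_rdistrib scaleR_matrix_vector_assoc[symmetric] algebra_simps)
    then have "?y = G *v ((s0 *\<^sub>R F - A) *v w) + (\<sigma> - s0) *\<^sub>R (G *v (F *v w))"
      by (simp add: matrix_vector_right_distrib matrix_vector_mult_scaleR)
    then have "?y = w + (\<sigma> - s0) *\<^sub>R (G *v (F *v w))"
      by (simp add: matrix_vector_mul_assoc G)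
    moreover have "a \<bullet> ?y = 0" "a \<bullet> w = 0"
      using a s0 y w unfolding annihilates_transfer_def by blast+
    ultimately have "(\<sigma> - s0) * (a \<bullet> (G *v (F *v w))) = 0" by (simp add: inner_add_right)
    then show "(a v* (G ** F)) \<bullet> w = 0"
      using \<sigma> by (simp add: dot_lmul_matrix matrix_vector_mul_assoc)
  qed
qed

text \<open>
  A real vector regarded as a complex one.
\<close>

definition cvec :: "real^'n \<Rightarrow> complex^'n" where
  "cvec x = (\<chi> i. complex_of_real (x $ i))"

lemma cvec_eq_0: "cvec x = 0 \<longleftrightarrow> x = 0"
  by (simp add: cvec_def vec_eq_iff)

lemma cvec_mult_cmat: "cvec x v* cmat M = cvec (x v* M)"
  by (simp add: cvec_def cmat_def vector_matrix_mult_def vec_eq_iff)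

lemma cmat_mult: "cmat (M ** N) = cmat M ** cmat N"
  by (simp add: cmat_def matrix_matrix_mult_def vec_eq_iff)

lemma cmat_one: "cmat (mat 1) = mat 1"
  by (simp add: cmat_def mat_def vec_eq_iff)

lemma linear_vector_matrix_mult: "Vector_Spaces.linear (*s) (*s) (\<lambda>x. x v* (M :: 'a::field^'n^'m))"
  by unfold_locales (simp_all add: vector_matrix_left_distrib scalar_vector_matrix_assoc
      vector_smult_assoc vector_sadd_rdistrib vector_add_ldistrib)

lemma left_inverse_det:
  fixes G R :: "real^'n^'n"
  assumes "G ** R = mat 1"
  shows "R ** G = mat 1" "det R \<noteq> 0"
  using assms by (auto simp: matrix_left_right_inverse invertible_det_nz[symmetric] invertible_def)

lemma annihilates_transfer_left_kernel:
  fixes F A :: "real^'n^'n" and B :: "real^'m^'n"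
  assumes G: "G ** (s0 *\<^sub>R F - A) = mat 1" and b: "annihilates_transfer F A B b"
  shows "b v* (G ** B) = 0"
proof -
  have "(b v* (G ** B)) \<bullet> h = 0" for h
  proof -
    have "(s0 *\<^sub>R F - A) *v (G *v (B *v h)) = B *v h"
      by (simp add: matrix_vector_mul_assoc matrix_mul_assoc left_inverse_det(1)[OF G])
    then have "b \<bullet> (G *v (B *v h)) = 0"
      using b left_inverse_det(2)[OF G] unfolding annihilates_transfer_def by blast
    then show ?thesis by (simp add: dot_lmul_matrix matrix_vector_mul_assoc)
  qed
  from this[of "b v* (G ** B)"] show ?thesis by simp
qed

lemma pencil_left_mult:
  "w v* pencil z F A = z *s (w v* cmat F) - w v* cmat A"
  by (simp add: pencil_def cmat_def vector_matrix_mult_def vec_eq_iff sum_distrib_left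
      sum_subtractf[symmetric] algebra_simps)

lemma left_mult_hcat_eq_0:
  "w v* hcat M N = 0 \<longleftrightarrow> w v* M = 0 \<and> w v* N = 0"
proof -
  have "(w v* hcat M N) $ j = (case j of Inl i \<Rightarrow> (w v* M) $ i | Inr i \<Rightarrow> (w v* N) $ i)" for j
    by (cases j) (simp_all add: hcat_def vector_matrix_mult_def)
  then show ?thesis by (auto simp: vec_eq_iff split: sum.splits)
qed

text \<open>
  Let \<open>E = G F\<close>. A left eigenvector \<open>e\<close> of \<open>E\<close> with eigenvalue \<open>\<mu> \<noteq> 0\<close> and \<open>e G B = 0\<close> would give the vector
  \<open>w = e G\<close> in the left kernel of \<open>[z F - A | B]\<close> for \<open>z = s0 - 1 / \<mu>\<close>. Hence \<open>E\<close> acts nilpotently on the functionals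
  that annihilate all \<open>E\<^sup>k G B\<close>.
\<close>

lemma full_rank_pencil_nilpotent:
  fixes F A :: "real^'n^'n" and B :: "real^'m^'n"
  assumes G: "G ** (s0 *\<^sub>R F - A) = mat 1"
    and hautus: "\<And>z. rank (hcat (pencil z F A) (cmat B)) = CARD('n)"
    and a: "annihilates_transfer F A B a"
  shows "\<exists>k. ((\<lambda>x. x v* (G ** F)) ^^ k) a = 0"
proof -
  define T where "T = (\<lambda>c. c v* cmat (G ** F))"
  define N where "N = {c. \<forall>k. (T ^^ k) c v* cmat (G ** B) = 0}"
  have lin: "Vector_Spaces.linear (*s) (*s) T" unfolding T_def by (rule linear_vector_matrix_mult)
  interpret T: Vector_Spaces.linear "(*s)" "(*s)" T by (rule lin)
  have add: "(T ^^ k) (x + y) = (T ^^ k) x + (T ^^ k) y" for k x y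
    by (induction k) (simp_all add: T.add)
  have scale: "(T ^^ k) (c *s x) = c *s (T ^^ k) x" for k c x
    by (induction k) (simp_all add: T.scale)
  have zero: "(T ^^ k) 0 = 0" for k by (induction k) (simp_all add: T.zero)
  have N: "vec.subspace N"
    unfolding vec.subspace_def N_def
    by (auto simp: add scale zero vector_matrix_left_distrib scalar_vector_matrix_assoc)
  have inv: "T x \<in> N" if "x \<in> N" for x
    unfolding N_def
  proof (intro CollectI allI)
    fix k
    have "(T ^^ Suc k) x v* cmat (G ** B) = 0" using that unfolding N_def by blast
    then show "(T ^^ k) (T x) v* cmat (G ** B) = 0" by (simp add: funpow_swap1)
  qed
  have no_eigen: "e = 0" if e: "e \<in> N" "T e = \<mu> *s e" "\<mu> \<noteq> 0" for \<mu> e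
  proof -
    define w where "w = e v* cmat G"
    have wF: "w v* cmat F = \<mu> *s e"
      using e(2) by (simp add: w_def T_def vector_matrix_mul_assoc cmat_mult)
    have "w v* cmat (s0 *\<^sub>R F - A) = e"
      by (simp add: w_def vector_matrix_mul_assoc cmat_mult[symmetric] G cmat_one)
    moreover have "w v* cmat (s0 *\<^sub>R F - A) = complex_of_real s0 *s (w v* cmat F) - w v* cmat A"
      by (simp add: cmat_def vector_matrix_mult_def vec_eq_iff sum_distrib_left
          sum_subtractf[symmetric] algebra_simps)
    ultimately have eA: "w v* cmat A = complex_of_real s0 *s (w v* cmat F) - e"
      by (simp add: algebra_simps)
    have "w v* pencil (complex_of_real s0 - 1 / \<mu>) F A = 0"
      unfolding pencil_left_mult eA wF using e(3) by (simp add: vec_eq_iff field_simps)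
    moreover have "w v* cmat B = 0"
    proof -
      have "(T ^^ 0) e v* cmat (G ** B) = 0" using e(1) unfolding N_def by blast
      then show ?thesis by (simp add: w_def vector_matrix_mul_assoc cmat_mult)
    qed
    ultimately have "w = 0"
      using full_rank_left_kernel[OF hautus] by (simp add: left_mult_hcat_eq_0)
    then show "e = 0" using \<open>w v* cmat (s0 *\<^sub>R F - A) = e\<close> by simp
  qed
  have pow: "(T ^^ k) (cvec a) = cvec (((\<lambda>x. x v* (G ** F)) ^^ k) a)" for k
    by (induction k) (simp_all add: T_def cvec_mult_cmat)
  have ann: "annihilates_transfer F A B (((\<lambda>x. x v* (G ** F)) ^^ k) a)" for k
    by (induction k) (simp_all add: a annihilates_transfer_shift[OF G])
  have "cvec a \<in> N"
    unfolding N_def mem_Collect_eq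
    by (simp add: pow cvec_mult_cmat cvec_eq_0 annihilates_transfer_left_kernel[OF G ann])
  then have "\<exists>k. (T ^^ k) (cvec a) = 0"
    using nilpotent_if_no_eigenvector[OF lin N] inv no_eigen by meson
  then show ?thesis by (simp add: pow cvec_eq_0)
qed

lemma zero_derivative_of_zero:
  fixes f :: "real \<Rightarrow> real"
  assumes "(f has_vector_derivative d) (at t within {0..})" "\<And>t. 0 \<le> t \<Longrightarrow> f t = 0" "0 \<le> t"
  shows "d = 0"
proof -
  have "((\<lambda>t. 0::real) has_vector_derivative d) (at t within {0..})"
    by (rule has_vector_derivative_transform[OF _ _ assms(1)]) (use assms(2,3) in auto)
  moreover have "{0..} \<noteq> {a :: real}" for a
  proof -
    have "0 \<in> {0::real..}" "1 \<in> {0::real..}" by simp_all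
    then show ?thesis by (metis singletonD zero_neq_one)
  qed
  then have "t islimpt {0..}" using assms(3) by (intro connected_imp_perfect) auto
  then have "at t within {0..} \<noteq> bot" by (simp add: trivial_limit_within)
  ultimately show ?thesis
    by (rule vector_derivative_unique_within[rotated, OF _ has_vector_derivative_const])
qed

text \<open>
  Multiplying the system by \<open>G\<close> gives \<open>x = E (s0 x - x') + G B u\<close>. Hence if \<open>a E\<close> vanishes along the trajectory, and
  therefore also on its derivative, then so does \<open>a\<close>.
\<close>

lemma annihilates_consistent_states:
  fixes F A :: "real^'n^'n" and B :: "real^'m^'n"
  assumes G: "G ** (s0 *\<^sub>R F - A) = mat 1"
    and a: "annihilates_transfer F A B a" and nil: "((\<lambda>x. x v* (G ** F)) ^^ k) a = 0"
    and traj: "is_controlled_trajectory F A B u x" and "0 \<le> t"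
  shows "a \<bullet> x t = 0"
  using a nil \<open>0 \<le> t\<close>
proof (induction k arbitrary: a t)
  case 0
  then show ?case by simp
next
  case (Suc k)
  let ?a' = "a v* (G ** F)"
  have a': "?a' \<bullet> x t = 0" if "0 \<le> t" for t
    using that Suc.prems(1,2) unfolding funpow_Suc_right o_apply
    by (intro Suc.IH annihilates_transfer_shift[OF G])
  obtain v where v: "(x has_vector_derivative v) (at t within {0..})" "F *v v = A *v x t + B *v u t"
    using traj Suc.prems(3) unfolding is_controlled_trajectory_def is_trajectory_def by blast
  have "((\<lambda>t. ?a' \<bullet> x t) has_vector_derivative ?a' \<bullet> v) (at t within {0..})"
    using bounded_linear.has_vector_derivative[OF bounded_linear_inner_right v(1)] .
  from zero_derivative_of_zero[OF this a' Suc.prems(3)] have "?a' \<bullet> v = 0" .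
  then have "a \<bullet> (G *v (F *v v)) = 0" by (simp add: dot_lmul_matrix matrix_vector_mul_assoc)
  moreover have "(s0 *\<^sub>R F - A) *v x t = s0 *\<^sub>R (F *v x t) - A *v x t"
    by (simp add: matrix_vector_mult_diff_rdistrib scaleR_matrix_vector_assoc)
  then have "F *v v = s0 *\<^sub>R (F *v x t) - (s0 *\<^sub>R F - A) *v x t + B *v u t" by (simp add: v(2))
  then have "G *v (F *v v) = s0 *\<^sub>R (G *v (F *v x t)) - G *v ((s0 *\<^sub>R F - A) *v x t) + G *v (B *v u t)"
    by (simp add: matrix_vector_right_distrib matrix_vector_mult_diff_distrib matrix_vector_mult_scaleR)
  then have "G *v (F *v v) = s0 *\<^sub>R (G *v (F *v x t)) - x t + G *v (B *v u t)"
    by (simp only: matrix_vector_mul_assoc G matrix_vector_mul_lid)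
  moreover have "a \<bullet> (G *v (F *v x t)) = 0"
    using a'[OF Suc.prems(3)] by (simp add: dot_lmul_matrix matrix_vector_mul_assoc)
  moreover have "a \<bullet> (G *v (B *v u t)) = (a v* (G ** B)) \<bullet> u t"
    by (simp add: dot_lmul_matrix matrix_vector_mul_assoc)
  then have "a \<bullet> (G *v (B *v u t)) = 0"
    by (simp add: annihilates_transfer_left_kernel[OF G Suc.prems(1)])
  ultimately show ?case by (simp add: inner_add_right inner_diff_right)
qed

text \<open>
  All transfers can be achieved in time \<open>1\<close>, since the linear span of the endpoints of exponential
  trajectories contains all pairs of consistent states.
\<close>

theorem controllable_if_full_rank_pencil:
  fixes F A :: "real^'n^'n" and B :: "real^'m^'n"
  assumes "solvable F A"
    and hautus: "\<And>z. rank (hcat (pencil z F A) (cmat B)) = CARD('n)"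
  shows "controllable F A B"
  unfolding controllable_def
proof (intro ballI)
  obtain s0 where s0: "det (s0 *\<^sub>R F - A) \<noteq> 0" using solvable_imp_regular[OF assms(1)] by blast
  then obtain G where G: "G ** (s0 *\<^sub>R F - A) = mat 1"
    using invertible_det_nz[of "s0 *\<^sub>R F - A"] by (auto simp: invertible_def)
  fix x0 x1
  assume "x0 \<in> controlled_initial_states F A B" "x1 \<in> controlled_initial_states F A B"
  then obtain u x v y where x: "is_controlled_trajectory F A B u x" "x0 = x 0"
    and y: "is_controlled_trajectory F A B v y" "x1 = y 0"
    by (auto simp: controlled_initial_states_def)
  let ?P = "{(w, exp \<sigma> *\<^sub>R w) | \<sigma> w. \<exists>h. det (\<sigma> *\<^sub>R F - A) \<noteq> 0 \<and> (\<sigma> *\<^sub>R F - A) *v w = B *v h}"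
  have "(x0, x1) \<in> span ?P"
  proof (rule span_iff_orthogonal)
    fix c assume c: "\<And>p. p \<in> ?P \<Longrightarrow> c \<bullet> p = 0"
    obtain a b where ab: "c = (a, b)" by (cases c)
    have orth: "a \<bullet> w + exp \<sigma> * (b \<bullet> w) = 0"
      if "det (\<sigma> *\<^sub>R F - A) \<noteq> 0" "(\<sigma> *\<^sub>R F - A) *v w = B *v h" for \<sigma> w h
    proof -
      have "(w, exp \<sigma> *\<^sub>R w) \<in> ?P" using that by blast
      from c[OF this] show ?thesis by (simp add: ab inner_prod_def)
    qed
    have ann: "annihilates_transfer F A B a" "annihilates_transfer F A B b"
      by (rule exp_endpoints_orthogonal[OF s0], rule orth, assumption+)+
    obtain k where k: "((\<lambda>x. x v* (G ** F)) ^^ k) a = 0"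
      using full_rank_pencil_nilpotent[OF G hautus ann(1)] by blast
    obtain l where l: "((\<lambda>x. x v* (G ** F)) ^^ l) b = 0"
      using full_rank_pencil_nilpotent[OF G hautus ann(2)] by blast
    have "a \<bullet> x0 = 0" "b \<bullet> x1 = 0"
      using annihilates_consistent_states[OF G ann(1) k x(1), of 0]
        annihilates_consistent_states[OF G ann(2) l y(1), of 0] by (simp_all add: x(2) y(2))
    then show "c \<bullet> (x0, x1) = 0" by (simp add: ab inner_prod_def)
  qed
  also have "span ?P \<subseteq> {p. \<exists>u x. is_controlled_trajectory F A B u x \<and> p = (x 0, x 1)}"
  proof (rule span_minimal[OF _ subspace_controlled_endpoints], safe)
    fix \<sigma> w h assume "(\<sigma> *\<^sub>R F - A) *v w = B *v h"
    from controlled_trajectory_exp[OF this]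
    show "\<exists>u x. is_controlled_trajectory F A B u x \<and> (w, exp \<sigma> *\<^sub>R w) = (x 0, x 1)"
      by (intro exI conjI) (assumption, simp)
  qed
  finally obtain u x where "is_controlled_trajectory F A B u x" "x 0 = x0" "x 1 = x1" by auto
  then show "\<exists>T>0. \<exists>u x. is_controlled_trajectory F A B u x \<and> x 0 = x0 \<and> x T = x1"
    by (intro exI[of _ 1]) auto
qed

section \<open>Controllability implies full rank\<close>

lemma invert_one_plus_nilpotent:
  fixes M :: "real^'n^'n"
  assumes "(((*v) M) ^^ j) z = 0"
  shows "\<exists>x. x + M *v x = z \<and> (((*v) M) ^^ j) x = 0"
  using assms
proof (induction j arbitrary: z)
  case 0
  then show ?case by (intro exI[of _ 0]) simp
next
  case (Suc j)
  have diff: "(((*v) M) ^^ i) (p - q) = (((*v) M) ^^ i) p - (((*v) M) ^^ i) q" for i p q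
    by (induction i) (simp_all add: matrix_vector_mult_diff_distrib)
  have "(((*v) M) ^^ j) (M *v z) = 0" using Suc.prems by (simp add: funpow_swap1)
  from Suc.IH[OF this] obtain x where x: "x + M *v x = M *v z" "(((*v) M) ^^ j) x = 0" by blast
  have "(z - x) + M *v (z - x) = z" using x(1) by (simp add: matrix_vector_mult_diff_distrib algebra_simps)
  moreover have "(((*v) M) ^^ Suc j) (z - x) = 0"
    unfolding diff using Suc.prems x(2) by simp
  ultimately show ?case by blast
qed

text \<open>
  On the kernel of a power of \<open>M = G A = s0 G F - I\<close>, the matrix \<open>G F = (I + M) / s0\<close> is invertible, so that
  \<open>F X\<^sub>1 = A y\<close> can be solved with \<open>X\<^sub>1\<close> in a smaller kernel.
\<close>

lemma nilpotent_chain: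
  fixes F A G :: "real^'n^'n"
  assumes G: "G ** (s0 *\<^sub>R F - A) = mat 1" and s0: "s0 \<noteq> 0"
    and y: "(((*v) (G ** A)) ^^ j) y = 0"
  shows "\<exists>X. X 0 = y \<and> (\<forall>k. F *v X (Suc k) = A *v X k) \<and> (\<forall>k\<ge>j. X k = 0)"
  using y
proof (induction j arbitrary: y)
  case 0
  then show ?case by (intro exI[of _ "\<lambda>k. 0"]) simp
next
  case (Suc j)
  let ?M = "G ** A"
  have "(((*v) ?M) ^^ j) (?M *v y) = 0" using Suc.prems by (simp add: funpow_swap1)
  from invert_one_plus_nilpotent[OF this] obtain x where
    x: "x + ?M *v x = ?M *v y" "(((*v) ?M) ^^ j) x = 0" by blast
  let ?x1 = "s0 *\<^sub>R x"
  have scale: "(((*v) ?M) ^^ i) (c *\<^sub>R p) = c *\<^sub>R (((*v) ?M) ^^ i) p" for i c p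
    by (induction i) (simp_all add: matrix_vector_mult_scaleR)
  have "(((*v) ?M) ^^ j) ?x1 = 0" by (simp add: scale x(2))
  from Suc.IH[OF this] obtain X where
    X: "X 0 = ?x1" "\<forall>k. F *v X (Suc k) = A *v X k" "\<forall>k\<ge>j. X k = 0" by blast
  have "G *v ((s0 *\<^sub>R F - A) *v x) = x" by (simp add: matrix_vector_mul_assoc G)
  then have "G *v (F *v ?x1) = x + ?M *v x"
    by (simp add: matrix_vector_mult_diff_rdistrib matrix_vector_mult_diff_distrib
        scaleR_matrix_vector_assoc[symmetric] matrix_vector_mult_scaleR matrix_vector_mul_assoc algebra_simps)
  then have "G *v (F *v ?x1) = G *v (A *v y)" by (simp add: x(1) matrix_vector_mul_assoc)
  then have "(s0 *\<^sub>R F - A) *v (G *v (F *v ?x1)) = (s0 *\<^sub>R F - A) *v (G *v (A *v y))" by simp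
  then have F: "F *v ?x1 = A *v y"
    by (simp only: matrix_vector_mul_assoc[of "s0 *\<^sub>R F - A"] left_inverse_det(1)[OF G] matrix_vector_mul_lid)
  show ?case
  proof (intro exI[of _ "case_nat y X"] conjI allI impI)
    show "F *v case_nat y X (Suc k) = A *v case_nat y X k" for k
      using X(1,2) F by (cases k) simp_all
    show "case_nat y X k = 0" if "Suc j \<le> k" for k using that X(3) by (cases k) simp_all
  qed simp
qed

text \<open>
  The trajectory is \<open>\<Sum>k. t\<^sup>k / k! X\<^sub>k\<close>.
\<close>

lemma chain_trajectory:
  fixes F A :: "real^'n^'n"
  assumes chain: "\<forall>k. F *v X (Suc k) = A *v X k" and zero: "\<forall>k\<ge>j. X k = 0"
  shows "is_trajectory F A (\<lambda>t. 0) (\<lambda>t. X 0 + (\<Sum>k<j. (t ^ Suc k / fact (Suc k)) *\<^sub>R X (Suc k)))"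
  unfolding is_trajectory_def
proof (intro allI impI exI conjI)
  fix t :: real
  have der: "((\<lambda>t. t ^ Suc k / fact (Suc k)) has_real_derivative t ^ k / fact k) (at t within {0..})" for k
  proof -
    have "((\<lambda>t::real. t ^ Suc k / fact (Suc k)) has_real_derivative
        (real (Suc k) * t ^ k) / fact (Suc k)) (at t within {0..})"
      using DERIV_cdivide[OF DERIV_pow[of "Suc k" t "{0..}"], of "fact (Suc k)"] by simp
    moreover have "(real (Suc k) * t ^ k) / fact (Suc k) = t ^ k / fact k" by (simp del: of_nat_Suc)
    ultimately show ?thesis by simp
  qed
  have "((\<lambda>t. \<Sum>k<j. (t ^ Suc k / fact (Suc k)) *\<^sub>R X (Suc k)) has_vector_derivative
      (\<Sum>k<j. (t ^ k / fact k) *\<^sub>R X (Suc k))) (at t within {0..})"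
    using has_vector_derivative_scaleR[OF der has_vector_derivative_const]
    by (intro has_vector_derivative_sum) simp
  then show "((\<lambda>t. X 0 + (\<Sum>k<j. (t ^ Suc k / fact (Suc k)) *\<^sub>R X (Suc k))) has_vector_derivative
      (\<Sum>k<j. (t ^ k / fact k) *\<^sub>R X (Suc k))) (at t within {0..})"
    using has_vector_derivative_add[OF has_vector_derivative_const] by fastforce
  have mult_sum: "M *v (\<Sum>k<j. c k *\<^sub>R Y k) = (\<Sum>k<j. c k *\<^sub>R (M *v Y k))" for M :: "real^'n^'n" and c Y
    by (induction j) (simp_all add: matrix_vector_right_distrib matrix_vector_mult_scaleR)
  have X0: "X 0 + (\<Sum>k<j. (t ^ Suc k / fact (Suc k)) *\<^sub>R X (Suc k)) = (\<Sum>k<j. (t ^ k / fact k) *\<^sub>R X k)"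
  proof -
    have "(\<Sum>k<Suc j. (t ^ k / fact k) *\<^sub>R X k) = X 0 + (\<Sum>k<j. (t ^ Suc k / fact (Suc k)) *\<^sub>R X (Suc k))"
      by (subst sum.lessThan_Suc_shift) simp
    then show ?thesis using zero by simp
  qed
  show "F *v (\<Sum>k<j. (t ^ k / fact k) *\<^sub>R X (Suc k)) =
      A *v (X 0 + (\<Sum>k<j. (t ^ Suc k / fact (Suc k)) *\<^sub>R X (Suc k))) + 0"
    unfolding X0 mult_sum using chain by simp
qed

text \<open>
  The functional \<open>z = w F\<close> is constant along controlled trajectories and \<open>z M = 0\<close> for \<open>M = G A\<close>.
  With a linear relation \<open>\<Sum>k. c\<^sub>k M\<^sup>k z = 0\<close> and its first nonzero coefficient \<open>c\<^sub>j\<close>, the state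
  \<open>y = c\<^sub>j z + c\<^sub>j\<^sub>+\<^sub>1 M z + \<dots>\<close> satisfies \<open>M\<^sup>j y = 0\<close> and \<open>z \<bullet> y = c\<^sub>j (z \<bullet> z) \<noteq> 0\<close>. It is the initial state of
  a polynomial trajectory and cannot be steered to \<open>0\<close>.
\<close>

theorem controllable_imp_left_kernel_trivial:
  fixes F A :: "real^'n^'n" and B :: "real^'m^'n"
  assumes solv: "solvable F A" and contr: "controllable F A B"
    and wA: "w v* A = 0" and wB: "w v* B = 0"
  shows "w = 0"
proof (rule ccontr)
  assume "w \<noteq> 0"
  obtain s0 where s0: "det (s0 *\<^sub>R F - A) \<noteq> 0" using solvable_imp_regular[OF solv] by blast
  then obtain G where G: "G ** (s0 *\<^sub>R F - A) = mat 1"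
    using invertible_det_nz[of "s0 *\<^sub>R F - A"] by (auto simp: invertible_def)
  define z where "z = w v* F"
  have wR: "w v* (s0 *\<^sub>R F - A) = s0 *\<^sub>R z"
    by (simp add: vector_matrix_mult_diff_rdistrib wA vector_scaleR_matrix_ac z_def)
  have w: "w = s0 *\<^sub>R (z v* G)"
  proof -
    have "w v* (s0 *\<^sub>R F - A) v* G = w" by (simp add: vector_matrix_mul_assoc left_inverse_det(1)[OF G])
    then show ?thesis by (simp add: wR scaleR_vector_matrix_assoc)
  qed
  then have "s0 \<noteq> 0" "z \<noteq> 0" using \<open>w \<noteq> 0\<close> by auto
  let ?M = "G ** A"
  have "s0 *\<^sub>R (z v* ?M) = 0"
    using wA by (simp add: w scaleR_vector_matrix_assoc[symmetric] vector_matrix_mul_assoc[symmetric])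
  then have zM: "z v* ?M = 0" using \<open>s0 \<noteq> 0\<close> by simp
  obtain c where c: "(\<Sum>k\<le>CARD('n). c k *s (((*v) ?M) ^^ k) z) = 0" "\<exists>k\<le>CARD('n). c k \<noteq> 0"
    using linear_relation[of "\<lambda>k. (((*v) ?M) ^^ k) z"] by blast
  define j where "j = (LEAST k. k \<le> CARD('n) \<and> c k \<noteq> 0)"
  have j: "j \<le> CARD('n)" "c j \<noteq> 0"
    using LeastI_ex[of "\<lambda>k. k \<le> CARD('n) \<and> c k \<noteq> 0"] c(2) by (auto simp: j_def)
  have below: "c k = 0" if "k < j" for k
    using not_less_Least[of k "\<lambda>k. k \<le> CARD('n) \<and> c k \<noteq> 0"] that j(1) by (auto simp: j_def)
  define y where "y = (\<Sum>i\<le>CARD('n) - j. c (i + j) *s (((*v) ?M) ^^ i) z)"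
  have mult: "(((*v) ?M) ^^ j) (\<Sum>i\<in>I. d i *s p i) = (\<Sum>i\<in>I. d i *s (((*v) ?M) ^^ j) (p i))" for I :: "nat set" and d p
  proof -
    have a: "(((*v) ?M) ^^ j) (p + q) = (((*v) ?M) ^^ j) p + (((*v) ?M) ^^ j) q" for p q
      by (induction j) (simp_all add: matrix_vector_right_distrib)
    have s: "(((*v) ?M) ^^ j) (e *s p) = e *s (((*v) ?M) ^^ j) p" for e p
      by (induction j) (simp_all add: vector_scalar_commute)
    have 0: "(((*v) ?M) ^^ j) 0 = 0" by (induction j) simp_all
    show ?thesis by (induction I rule: infinite_finite_induct) (simp_all add: a s 0)
  qed
  have "(((*v) ?M) ^^ j) y = (\<Sum>i\<le>CARD('n) - j. c (i + j) *s (((*v) ?M) ^^ (i + j)) z)"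
    unfolding y_def mult by (simp add: funpow_add[symmetric] add.commute comp_def flip: funpow_add[THEN fun_cong, unfolded comp_def])
  also have "\<dots> = (\<Sum>k\<in>{j..CARD('n)}. c k *s (((*v) ?M) ^^ k) z)"
    by (rule sum.reindex_bij_witness[of _ "\<lambda>k. k - j" "\<lambda>i. i + j"]) (use j(1) in auto)
  also have "\<dots> = (\<Sum>k\<le>CARD('n). c k *s (((*v) ?M) ^^ k) z)"
    by (rule sum.mono_neutral_left) (use below in auto)
  finally have My: "(((*v) ?M) ^^ j) y = 0" using c(1) by simp
  have zM0: "z \<bullet> (((*v) ?M) ^^ Suc i) z = 0" for i
    by (simp add: dot_lmul_matrix[symmetric] zM)
  have "z \<bullet> y = (\<Sum>i\<le>CARD('n) - j. c (i + j) * (z \<bullet> (((*v) ?M) ^^ i) z))"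
    by (simp add: y_def inner_sum_right scalar_mult_eq_scaleR)
  also have "\<dots> = (\<Sum>i\<in>{0}. c (i + j) * (z \<bullet> (((*v) ?M) ^^ i) z))"
  proof (rule sum.mono_neutral_right)
    show "\<forall>i\<in>{..CARD('n) - j} - {0}. c (i + j) * (z \<bullet> (((*v) ?M) ^^ i) z) = 0"
    proof
      fix i assume "i \<in> {..CARD('n) - j} - {0}"
      then obtain k where "i = Suc k" by (cases i) auto
      then show "c (i + j) * (z \<bullet> (((*v) ?M) ^^ i) z) = 0" using zM0[of k] by simp
    qed
  qed auto
  finally have zy: "z \<bullet> y \<noteq> 0" using j(2) \<open>z \<noteq> 0\<close> by simp
  obtain X where X: "X 0 = y" "\<forall>k. F *v X (Suc k) = A *v X k" "\<forall>k\<ge>j. X k = 0"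
    using nilpotent_chain[OF G \<open>s0 \<noteq> 0\<close> My] by blast
  let ?x = "\<lambda>t. X 0 + (\<Sum>k<j. (t ^ Suc k / fact (Suc k)) *\<^sub>R X (Suc k))"
  have "is_controlled_trajectory F A B (\<lambda>t. 0) ?x"
    using chain_trajectory[OF X(2,3)] by (simp add: is_controlled_trajectory_def)
  moreover have "?x 0 = y" by (simp add: X(1))
  ultimately have y: "y \<in> controlled_initial_states F A B"
    unfolding controlled_initial_states_def by (intro CollectI exI[of _ ?x]) auto
  have "is_controlled_trajectory F A B (\<lambda>t. 0) (\<lambda>t. 0)"
    using trajectory_zero[of F A] by (simp add: is_controlled_trajectory_def)
  then have "0 \<in> controlled_initial_states F A B"
    unfolding controlled_initial_states_def by (intro CollectI exI[of _ "\<lambda>t. 0"]) auto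
  with y contr obtain T u x where T: "T > 0" and x: "is_controlled_trajectory F A B u x" "x 0 = y" "x T = 0"
    unfolding controllable_def by blast
  have "((\<lambda>t. z \<bullet> x t) has_vector_derivative 0) (at t within {0..T})" if "t \<in> {0..T}" for t
  proof -
    have "0 \<le> t" using that by simp
    then obtain v where v: "(x has_vector_derivative v) (at t within {0..})" "F *v v = A *v x t + B *v u t"
      using x(1) unfolding is_controlled_trajectory_def is_trajectory_def by blast
    have "((\<lambda>t. z \<bullet> x t) has_vector_derivative z \<bullet> v) (at t within {0..})"
      using bounded_linear.has_vector_derivative[OF bounded_linear_inner_right v(1)] .
    then have "((\<lambda>t. z \<bullet> x t) has_vector_derivative z \<bullet> v) (at t within {0..T})"
      by (rule has_vector_derivative_within_subset) auto
    moreover have "z \<bullet> v = (w v* A) \<bullet> x t + (w v* B) \<bullet> u t"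
      unfolding z_def dot_lmul_matrix v(2) by (simp add: inner_add_right)
    ultimately show ?thesis by (simp add: wA wB)
  qed
  then obtain d where "\<And>t. t \<in> {0..T} \<Longrightarrow> z \<bullet> x t = d"
    using has_vector_derivative_zero_constant[of "{0..T}" "\<lambda>t. z \<bullet> x t"] by auto
  from this[of 0] this[of T] show False using x zy T by simp
qed

section \<open>Optimality of the greedy input set\<close>

lemma full_rank_if_left_kernel_trivial:
  fixes M :: "real^'c^'r"
  assumes "\<And>w. w v* M = 0 \<Longrightarrow> w = 0"
  shows "rank M = CARD('r)"
proof -
  have "inj ((*v) (transpose M))"
  proof (rule injI)
    fix x y assume "transpose M *v x = transpose M *v y"
    then have "(x - y) v* M = 0" by (simp add: vector_matrix_mult_diff_distrib)
    then show "x = y" using assms by fastforce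
  qed
  then show ?thesis using full_rank_injective[of "transpose M"] by (simp add: rank_transpose)
qed

text \<open>
  Controllability at a single solvable parameter value already gives full rank there, hence maximal rank \<open>n\<close>.
\<close>

lemma structurally_controllable_iff_dual_matroid_M1:
  fixes QF QA :: "real^'n^'n"
  assumes solvable: "AE \<theta> in lborel. solvable (F_at QF PF \<theta>) (A_at QA PA \<theta>)"
    and rank_imp:
      "(AE \<theta> in lborel. rank (hcat (A_at QA PA \<theta>) (B_at S \<theta>)) = CARD('n)) \<Longrightarrow>
        (AE \<theta> in lborel. \<forall>z. rank (hcat (pencil z (F_at QF PF \<theta>) (A_at QA PA \<theta>))
                                          (cmat (B_at S \<theta>))) = CARD('n))"
  shows "structurally_controllable QF PF QA PA S \<longleftrightarrow> UNIV - S \<in> dual_matroid (matroid_M1 QA PA)"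
proof -
  have iff: "UNIV - S \<in> dual_matroid (matroid_M1 QA PA) \<longleftrightarrow>
      (\<exists>\<theta>. rank (controlled_mat QA PA S \<theta>) = CARD('n))"
    by (simp add: dual_matroid_M1_iff_full_rank double_diff)
  show ?thesis
    unfolding iff
  proof
    assume "structurally_controllable QF PF QA PA S"
    then have "AE \<theta> in lborel. controllable (F_at QF PF \<theta>) (A_at QA PA \<theta>) (B_at S \<theta>)"
      by (simp add: structurally_controllable_def)
    with solvable have AE: "AE \<theta> in lborel. solvable (F_at QF PF \<theta>) (A_at QA PA \<theta>) \<and>
        controllable (F_at QF PF \<theta>) (A_at QA PA \<theta>) (B_at S \<theta>)"
      by eventually_elim simp
    have "ae_filter (lborel :: 'n params measure) \<noteq> bot"
      by (simp add: ae_filter_eq_bot_iff)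
    from eventually_happens'[OF this AE] obtain \<theta> where
      \<theta>: "solvable (F_at QF PF \<theta>) (A_at QA PA \<theta>)" "controllable (F_at QF PF \<theta>) (A_at QA PA \<theta>) (B_at S \<theta>)"
      by (elim exE conjE)
    have "rank (controlled_mat QA PA S \<theta>) = CARD('n)"
      unfolding controlled_mat_def
      by (rule full_rank_if_left_kernel_trivial)
        (auto simp: left_mult_hcat_eq_0 intro: controllable_imp_left_kernel_trivial[OF \<theta>])
    then show "\<exists>\<theta>. rank (controlled_mat QA PA S \<theta>) = CARD('n)" ..
  next
    assume "\<exists>\<theta>. rank (controlled_mat QA PA S \<theta>) = CARD('n)"
    then have "AE \<theta> in lborel. rank (controlled_mat QA PA S \<theta>) = CARD('n)"
      by (elim exE) (rule AE_full_rank_controlled_mat)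
    then have "AE \<theta> in lborel. \<forall>z. rank (hcat (pencil z (F_at QF PF \<theta>) (A_at QA PA \<theta>))
        (cmat (B_at S \<theta>))) = CARD('n)"
      unfolding controlled_mat_def by (rule rank_imp)
    with solvable show "structurally_controllable QF PF QA PA S"
      unfolding structurally_controllable_def
      by eventually_elim (rule controllable_if_full_rank_pencil; simp)
  qed
qed

theorem lemma4p2:
  fixes QF QA :: "real^'n::{finite, linorder}^'n::{finite, linorder}"
    and PF PA :: "('n \<times> 'n) set"
  assumes solvable: "AE \<theta> in lborel. solvable (F_at QF PF \<theta>) (A_at QA PA \<theta>)"
    and connected: "AE \<theta> in lborel. strongly_connected (F_at QF PF \<theta>) (A_at QA PA \<theta>)"
    and rank_imp:
      "\<forall>S. (AE \<theta> in lborel. rank (hcat (A_at QA PA \<theta>) (B_at S \<theta>)) = CARD('n)) \<longrightarrow>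
        (AE \<theta> in lborel. \<forall>z. rank (hcat (pencil z (F_at QF PF \<theta>) (A_at QA PA \<theta>))
                                          (cmat (B_at S \<theta>))) = CARD('n))"
  shows "let indep = (\<lambda>R. R \<in> dual_matroid (matroid_M1 QA PA));
             S = UNIV - run_prog indep greedy
         in (\<forall>S'. structurally_controllable QF PF QA PA S' \<longleftrightarrow> indep (UNIV - S'))
          \<and> structurally_controllable QF PF QA PA S
          \<and> (\<forall>S'. structurally_controllable QF PF QA PA S' \<longrightarrow> card S \<le> card S')
          \<and> num_queries indep greedy \<le> CARD('n)"
proof -
  define indep where "indep = (\<lambda>R. R \<in> dual_matroid (matroid_M1 QA PA))"
  define S where "S = UNIV - run_prog indep greedy"
  let ?e = "\<lambda>i. axis i (1::real)"
  have sc: "structurally_controllable QF PF QA PA S' \<longleftrightarrow> indep (UNIV - S')" for S'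
    unfolding indep_def
    by (rule structurally_controllable_iff_dual_matroid_M1[OF solvable]) (use rank_imp in blast)
  obtain V where
    V: "\<And>S. dim (V \<union> ?e ` S) = CARD('n) \<longleftrightarrow> indep (UNIV - S)"
    using dual_matroid_M1_iff_full_rank(2)[of QA PA] unfolding indep_def by blast
  have le: "dim (V \<union> ?e ` S) \<le> CARD('n)" for S
    using dim_subset_UNIV[of "V \<union> ?e ` S"] by simp
  have down: "indep R" if "R \<subseteq> R'" "indep R'" for R R'
  proof -
    have "dim (V \<union> ?e ` (UNIV - R')) = CARD('n)" using that(2) V[of "UNIV - R'"] by (simp add: double_diff)
    moreover have "dim (V \<union> ?e ` (UNIV - R')) \<le> dim (V \<union> ?e ` (UNIV - R))"
      by (rule dim_subset) (use that(1) in auto)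
    ultimately have "dim (V \<union> ?e ` (UNIV - R)) = CARD('n)" using le[of "UNIV - R"] by simp
    then show ?thesis using V[of "UNIV - R"] by (simp add: double_diff)
  qed
  have "dim (V \<union> range ?e) = CARD('n)"
    using span_range_axis[of V] dim_span[of "V \<union> range ?e"] by simp
  then have "indep {}" using V[of UNIV] by simp
  have greedy: "indep (UNIV - S)" "\<And>i. i \<in> S \<Longrightarrow> \<not> indep (insert i (UNIV - S))"
    using greedy_loop_maximal[of indep "{}" "sorted_list_of_set UNIV", OF down \<open>indep {}\<close>]
    by (simp_all add: S_def greedy_def double_diff)
  have "card S \<le> card S'" if "indep (UNIV - S')" for S'
  proof (rule minimal_completion_card_le)
    show "dim (V \<union> ?e ` S) = DIM((real, 'n) vec)" "dim (V \<union> ?e ` S') = DIM((real, 'n) vec)"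
      using V greedy(1) that by simp_all
    fix i assume "i \<in> S"
    then have "UNIV - (S - {i}) = insert i (UNIV - S)" by blast
    then show "dim (V \<union> ?e ` (S - {i})) \<noteq> DIM((real, 'n) vec)"
      using V[of "S - {i}"] greedy(2)[OF \<open>i \<in> S\<close>] by simp
  qed
  moreover have "num_queries indep greedy \<le> CARD('n)"
    by (simp add: greedy_def num_queries_greedy_loop)
  ultimately show ?thesis
    using sc greedy(1) unfolding Let_def indep_def[symmetric] S_def[symmetric] by simp
qed

end
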